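(* Let $(G_n)_{n}$ be a family of simple undirected graphs, $G_n$ having vertex set $[n]$, and for each $n$ let $Q_n$ be a face of $\mathrm{NPT}(\mathrm{pf}(T_{G_n}))$. Then the family $\{\mathrm{pf}(T_{G_n})|_{Q_n}\}_n$ belongs to $\mathrm{VP}_{\mathrm{ws}}$; i.e. there is a polynomial $p$, independent of the graphs and faces, such that for every graph $G$ on vertex set $[n]$ and every face $Q$ of $\mathrm{NPT}(\mathrm{pf}(T_G))$, $\mathrm{pf}(T_G)|_Q$ is computed by a weakly skew arithmetic circuit of size at most $p(n)$.
   Context: Work over an algebraically closed field $\mathbb{F}$. For a simple graph $G=([n],E)$ with variables $\{x_e:e\in E\}$, the Tutte matrix $T_G$ is the $n\times n$ skew-symmetric matrix with $T_G(i,j)=x_e$, $T_G(j,i)=-x_e$ if $e=\{i,j\}\in E$, $i<j$, and $0$ otherwise. $\mathrm{pf}(T_G)$ is its Pfaffian, $\mathrm{pf}(T_G)=\sum_P\mathrm{sgn}(P)\prod_{e\in P}x_e$ over perfect matchings $P$ of $G$. For $f=\sum_{\mathbf{e}}\alpha_{\mathbf{e}}\mathbf{x}^{\mathbf{e}}$, $\mathrm{NPT}(f)$ is the convex hull of exponent vectors with nonzero coefficient; a face of a polytope $P$ is $P\cap\{v:\ell(v)=c\}$ with $\ell$ linear and $\ell\ge c$ on $P$; $f|_Q=\sum_{\mathbf{e}\in Q}\alpha_{\mathbf{e}}\mathbf{x}^{\mathbf{e}}$. A weakly skew circuit is an arithmetic circuit in which, for every multiplication gate, at least one of its two inputs is the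 output of a subcircuit whose gates have no connections to the rest of the circuit other than through this multiplication gate. $\mathrm{VP}_{\mathrm{ws}}$ is the class of families of polynomials computed by weakly skew circuits of polynomial size (equivalently, by polynomial-size symbolic determinants, i.e. determinants of matrices whose entries are affine linear forms in the variables). *)

theory Defs
  imports
    "HOL-Analysis.Analysis"
    "HOL-Analysis.Finite_Function_Topology"
    "HOL-Combinatorics.Permutations"
    "HOL-Computational_Algebra.Polynomial"
begin

section \<open>Polynomials and Newton polytopes\<close>

text \<open>
  A multivariate polynomial maps each exponent vector (a finitely supported function from the
  variables to the naturals) to its coefficient; ring operations are those of
  \<^theory>\<open>HOL-Library.Poly_Mapping\<close>.
\<close>

type_synonym ('v, 'a) mpoly = "('v \<Rightarrow>\<^sub>0 nat) \<Rightarrow>\<^sub>0 'a"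

definition mconst :: "'a::comm_ring_1 \<Rightarrow> ('v, 'a) mpoly" where
  "mconst c = Poly_Mapping.single 0 c"

definition mvar :: "'v \<Rightarrow> ('v, 'a::comm_ring_1) mpoly" where
  "mvar v = Poly_Mapping.single (Poly_Mapping.single v 1) 1"

text \<open>
  The ambient real vector space consists of the finitely supported real functions on all
  variable names. Coordinates of variables not occurring in the polynomial vanish on its Newton
  polytope, and every linear functional on a coordinate subspace extends to the whole space, so
  polytope and faces are the same as in the space indexed by the occurring variables only.
\<close>

definition exponent_point :: "('v \<Rightarrow>\<^sub>0 nat) \<Rightarrow> ('v \<Rightarrow>\<^sub>0 real)" where
  "exponent_point m = Poly_Mapping.map real m"

definition NPT :: "('v, 'a::comm_ring_1) mpoly \<Rightarrow> ('v \<Rightarrow>\<^sub>0 real) set" where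
  "NPT f = convex hull (exponent_point ` Poly_Mapping.keys f)"

text \<open>
  A face is cut out by a linear inequality that is valid on the polytope. The polytope itself and
  the empty set are faces.
\<close>

definition is_face :: "'b::real_vector set \<Rightarrow> 'b set \<Rightarrow> bool" where
  "is_face Q P \<longleftrightarrow>
     (\<exists>(l :: 'b \<Rightarrow> real) c. linear l \<and> (\<forall>v\<in>P. c \<le> l v) \<and> Q = P \<inter> {v. l v = c})"

definition restrict_poly ::
    "('v, 'a::comm_ring_1) mpoly \<Rightarrow> ('v \<Rightarrow>\<^sub>0 real) set \<Rightarrow> ('v, 'a) mpoly" where
  "restrict_poly f Q =
     (\<Sum>m | m \<in> Poly_Mapping.keys f \<and> exponent_point m \<in> Q.
        Poly_Mapping.single m (Poly_Mapping.lookup f m))"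


section \<open>Tutte matrices and Pfaffians\<close>

text \<open>Edges are two-element sets of vertices.\<close>

definition complete_edges :: "nat \<Rightarrow> nat set set" where
  "complete_edges n = {e. e \<subseteq> {1..n} \<and> card e = 2}"

definition simple_graph :: "nat \<Rightarrow> nat set set \<Rightarrow> bool" where
  "simple_graph n E \<longleftrightarrow> E \<subseteq> complete_edges n"

definition perfect_matchings :: "nat \<Rightarrow> nat set set \<Rightarrow> nat set set set" where
  "perfect_matchings n E = {P. P \<subseteq> E \<and> partition_on {1..n} P}"

text \<open>
  The sign of a perfect matching \<open>{{i\<^sub>1, j\<^sub>1}, \<dots>, {i\<^sub>k, j\<^sub>k}}\<close> with \<open>i\<^sub>r < j\<^sub>r\<close> and
  \<open>i\<^sub>1 < \<dots> < i\<^sub>k\<close> is the sign of the permutation of \<open>{1..n}\<close> with one-line notation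
  \<open>i\<^sub>1 j\<^sub>1 \<dots> i\<^sub>k j\<^sub>k\<close>. (The order of the pairs does not affect the sign; it is fixed only to make
  the permutation a function of the matching.)
\<close>

definition matching_word :: "nat set set \<Rightarrow> nat list" where
  "matching_word P = concat (map (\<lambda>e. [Min e, Max e]) (sorted_key_list_of_set Min P))"

definition matching_perm :: "nat \<Rightarrow> nat set set \<Rightarrow> nat \<Rightarrow> nat" where
  "matching_perm n P i = (if i \<in> {1..n} then matching_word P ! (i - 1) else i)"

definition matching_sign :: "nat \<Rightarrow> nat set set \<Rightarrow> int" where
  "matching_sign n P = sign (matching_perm n P)"

text \<open>Pfaffian of a skew-symmetric matrix with rows and columns indexed by \<open>{1..n}\<close>.\<close>

definition pfaffian :: "nat \<Rightarrow> (nat \<Rightarrow> nat \<Rightarrow> 'a::comm_ring_1) \<Rightarrow> 'a" where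
  "pfaffian n A =
     (\<Sum>P\<in>perfect_matchings n (complete_edges n).
        of_int (matching_sign n P) * (\<Prod>e\<in>P. A (Min e) (Max e)))"

definition tutte_matrix ::
    "nat set set \<Rightarrow> nat \<Rightarrow> nat \<Rightarrow> (nat set, 'a::comm_ring_1) mpoly" where
  "tutte_matrix E i j =
     (if {i, j} \<in> E \<and> i < j then mvar {i, j}
      else if {i, j} \<in> E \<and> j < i then - mvar {i, j}
      else 0)"

definition tutte_pfaffian :: "nat \<Rightarrow> nat set set \<Rightarrow> (nat set, 'a::comm_ring_1) mpoly" where
  "tutte_pfaffian n E = pfaffian n (tutte_matrix E)"

lemma complete_edge_Min_Max:
  assumes "e \<in> complete_edges n"
  shows "finite e" "Min e < Max e" "{Min e, Max e} = e" "e \<subseteq> {1..n}"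
proof -
  obtain a b where e: "e = {a, b}" "a \<noteq> b" and sub: "e \<subseteq> {1..n}"
    using assms by (auto simp: complete_edges_def card_2_iff)
  show "finite e" using e by simp
  show "Min e < Max e" using e by (auto simp: min_def max_def)
  show "{Min e, Max e} = e" using e by (auto simp: min_def max_def)
  show "e \<subseteq> {1..n}" by (fact sub)
qed

lemma finite_complete_edges: "finite (complete_edges n)"
  by (rule finite_subset[of _ "Pow {1..n}"]) (auto simp: complete_edges_def)

lemma matching_perm_permutes:
  assumes "P \<in> perfect_matchings n (complete_edges n)"
  shows "matching_perm n P permutes {1..n}"
proof -
  define xs where "xs = sorted_key_list_of_set Min P"
  have PE: "P \<subseteq> complete_edges n" and part: "partition_on {1..n} P"
    using assms by (auto simp: perfect_matchings_def)
  have fin: "finite P" using PE finite_complete_edges finite_subset by blast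
  have disj: "e = e'" if "e \<in> P" "e' \<in> P" "x \<in> e" "x \<in> e'" for e e' x
    using part that unfolding partition_on_def disjoint_def by blast
  have inj: "inj_on Min P"
  proof (rule inj_onI)
    fix e e' assume *: "e \<in> P" "e' \<in> P" "Min e = Min e'"
    then have "Min e \<in> e" "Min e \<in> e'"
      using complete_edge_Min_Max(3) PE by (metis insertI1 subsetD)+
    then show "e = e'" using disj * by blast
  qed
  interpret key: folding_insort_key "(\<le>)" "(<)" P Min
    rewrites "linorder.sorted_key_list_of_set (\<le>) Min = sorted_key_list_of_set Min"
  proof -
    show "folding_insort_key (\<le>) (<) P Min" by unfold_locales (fact inj)
    show "linorder.sorted_key_list_of_set (\<le>) Min = sorted_key_list_of_set Min"
      unfolding sorted_key_list_of_set_def insort_key_def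
        linorder.sorted_key_list_of_set_def[OF linorder_class.linorder_axioms]
        linorder.insort_key_def[OF linorder_class.linorder_axioms] ..
  qed
  have set_xs: "set xs = P"
    using fin by (simp add: xs_def)
  have dist_xs: "distinct xs"
    using key.distinct_sorted_key_list_of_set[of P] by (simp add: xs_def distinct_map)
  have Min_Max: "{Min e, Max e} = e" "Min e \<noteq> Max e" if "e \<in> P" for e
    using complete_edge_Min_Max[of e n] PE that by auto
  have word: "matching_word P = concat (map (\<lambda>e. [Min e, Max e]) xs)"
    by (simp add: matching_word_def xs_def)
  have "distinct (concat (map (\<lambda>e. [Min e, Max e]) ys))" if "set ys \<subseteq> P" "distinct ys" for ys
    using that
  proof (induction ys)
    case (Cons e ys)
    have "x \<notin> e" if "x \<in> e'" "e' \<in> set ys" for x e'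
      using disj[of e e' x] Cons.prems that by auto
    moreover have "Min e \<in> e" "Max e \<in> e" "Min e \<noteq> Max e"
      using Min_Max[of e] Cons.prems by auto
    moreover have "Min e' \<in> e'" "Max e' \<in> e'" if "e' \<in> set ys" for e'
      using Min_Max[of e'] Cons.prems that by auto
    ultimately show ?case using Cons by (auto; metis)
  qed simp
  then have dist: "distinct (matching_word P)"
    using set_xs dist_xs word by simp
  have "set (matching_word P) = (\<Union>e\<in>P. {Min e, Max e})"
    by (simp add: word set_xs)
  also have "\<dots> = {1..n}"
    using part Min_Max(1) by (simp add: partition_on_def)
  finally have set_word: "set (matching_word P) = {1..n}" .
  then have len: "length (matching_word P) = n"
    using distinct_card[OF dist] by simp
  have "bij_betw (\<lambda>i. i - 1) {1..n} {..<n}"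
    by (rule bij_betwI[of _ _ _ Suc]) auto
  moreover have "bij_betw (nth (matching_word P)) {..<n} {1..n}"
    using bij_betw_nth[OF dist] len set_word by simp
  ultimately have "bij_betw (nth (matching_word P) \<circ> (\<lambda>i. i - 1)) {1..n} {1..n}"
    by (rule bij_betw_trans)
  then have "bij_betw (matching_perm n P) {1..n} {1..n}"
    by (rule bij_betw_cong[THEN iffD1, rotated]) (simp add: matching_perm_def)
  then show ?thesis
    by (rule bij_imp_permutes) (auto simp: matching_perm_def)
qed

lemma tutte_pfaffian_eq:
  assumes "simple_graph n E"
  shows "(tutte_pfaffian n E :: (nat set, 'a::comm_ring_1) mpoly) =
    (\<Sum>P\<in>perfect_matchings n E. of_int (matching_sign n P) * (\<Prod>e\<in>P. mvar e))"
proof -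
  have "(tutte_pfaffian n E :: (nat set, 'a) mpoly) =
     (\<Sum>P\<in>perfect_matchings n E. of_int (matching_sign n P) *
        (\<Prod>e\<in>P. tutte_matrix E (Min e) (Max e)))"
    unfolding tutte_pfaffian_def pfaffian_def
  proof (rule sum.mono_neutral_right)
    show "finite (perfect_matchings n (complete_edges n))"
      by (rule finite_subset[of _ "Pow (complete_edges n)"])
         (auto simp: perfect_matchings_def finite_complete_edges)
    show "perfect_matchings n E \<subseteq> perfect_matchings n (complete_edges n)"
      using assms by (auto simp: perfect_matchings_def simple_graph_def)
    show "\<forall>P\<in>perfect_matchings n (complete_edges n) - perfect_matchings n E.
       of_int (matching_sign n P) * (\<Prod>e\<in>P. tutte_matrix E (Min e) (Max e)) =
         (0 :: (nat set, 'a) mpoly)"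
    proof
      fix P assume P: "P \<in> perfect_matchings n (complete_edges n) - perfect_matchings n E"
      then have PE: "P \<subseteq> complete_edges n" by (auto simp: perfect_matchings_def)
      obtain e where e: "e \<in> P" "e \<notin> E" using P by (auto simp: perfect_matchings_def)
      have "tutte_matrix E (Min e) (Max e) = (0 :: (nat set, 'a) mpoly)"
        using e PE complete_edge_Min_Max(3)[of e n] by (auto simp: tutte_matrix_def)
      moreover have "finite P" using PE finite_complete_edges finite_subset by blast
      ultimately have "(\<Prod>e\<in>P. tutte_matrix E (Min e) (Max e)) = (0 :: (nat set, 'a) mpoly)"
        using e by (metis (mono_tags, lifting) prod_zero)
      then show "of_int (matching_sign n P) * (\<Prod>e\<in>P. tutte_matrix E (Min e) (Max e)) =
         (0 :: (nat set, 'a) mpoly)" by simp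
    qed
  qed
  also have "\<dots> = (\<Sum>P\<in>perfect_matchings n E. of_int (matching_sign n P) * (\<Prod>e\<in>P. mvar e))"
  proof (intro sum.cong refl arg_cong2[where f = "(*)"] prod.cong)
    fix P e assume "P \<in> perfect_matchings n E" "e \<in> P"
    then have "e \<in> E" "e \<in> complete_edges n"
      using assms by (auto simp: perfect_matchings_def simple_graph_def)
    then show "tutte_matrix E (Min e) (Max e) = (mvar e :: (nat set, 'a) mpoly)"
      using complete_edge_Min_Max[of e n] by (auto simp: tutte_matrix_def)
  qed
  finally show ?thesis .
qed


section \<open>Weakly skew circuits\<close>

text \<open>
  A circuit is the list of its gates in a topological order; gates refer to their inputs by
  position. The last gate is the output. A variable or constant used in several places may be
  read from several input gates, each of which counts towards the size.
\<close>

datatype ('v, 'a) gate = Var 'v | Const 'a | Add nat nat | Mul nat nat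

type_synonym ('v, 'a) circuit = "('v, 'a) gate list"

fun gate_inputs :: "('v, 'a) gate \<Rightarrow> nat set" where
  "gate_inputs (Var v) = {}"
| "gate_inputs (Const c) = {}"
| "gate_inputs (Add i j) = {i, j}"
| "gate_inputs (Mul i j) = {i, j}"

definition wf_circuit :: "('v, 'a) circuit \<Rightarrow> bool" where
  "wf_circuit C \<longleftrightarrow> C \<noteq> [] \<and> (\<forall>k<length C. \<forall>i\<in>gate_inputs (C ! k). i < k)"

fun gate_value :: "('v, 'a::comm_ring_1) mpoly list \<Rightarrow> ('v, 'a) gate \<Rightarrow> ('v, 'a) mpoly" where
  "gate_value vs (Var v) = mvar v"
| "gate_value vs (Const c) = mconst c"
| "gate_value vs (Add i j) = vs ! i + vs ! j"
| "gate_value vs (Mul i j) = vs ! i * vs ! j"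

definition circuit_values :: "('v, 'a::comm_ring_1) circuit \<Rightarrow> ('v, 'a) mpoly list" where
  "circuit_values C = foldl (\<lambda>vs g. vs @ [gate_value vs g]) [] C"

definition circuit_poly :: "('v, 'a::comm_ring_1) circuit \<Rightarrow> ('v, 'a) mpoly" where
  "circuit_poly C = last (circuit_values C)"

definition wires :: "('v, 'a) circuit \<Rightarrow> (nat \<times> nat) set" where
  "wires C = {(i, k). k < length C \<and> i \<in> gate_inputs (C ! k)}"

definition subcircuit :: "('v, 'a) circuit \<Rightarrow> nat \<Rightarrow> nat set" where
  "subcircuit C i = {l. (l, i) \<in> (wires C)\<^sup>*}"

text \<open>
  \<open>private_input C k i j\<close>: the subcircuit with output \<open>i\<close> is connected to the rest of the circuit
  only through the input \<open>i\<close> of the multiplication gate \<open>k\<close>, whose other input is \<open>j\<close>. The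
  condition on \<open>j\<close> is not redundant: it forbids the second input of \<open>k\<close> from reading the
  subcircuit, in particular \<open>i = j\<close>; otherwise repeated squaring would be weakly skew.
\<close>

definition private_input :: "('v, 'a) circuit \<Rightarrow> nat \<Rightarrow> nat \<Rightarrow> nat \<Rightarrow> bool" where
  "private_input C k i j \<longleftrightarrow>
     j \<notin> subcircuit C i \<and>
     (\<forall>(l, m)\<in>wires C. l \<in> subcircuit C i \<longrightarrow> m \<in> subcircuit C i \<or> m = k)"

definition weakly_skew :: "('v, 'a) circuit \<Rightarrow> bool" where
  "weakly_skew C \<longleftrightarrow>
     wf_circuit C \<and>
     (\<forall>k i j. k < length C \<and> C ! k = Mul i j \<longrightarrow> private_input C k i j \<or> private_input C k j i)"

definition VP_ws :: "(nat \<Rightarrow> ('v, 'a::comm_ring_1) mpoly) set" where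
  "VP_ws = {f. \<exists>p :: nat poly. \<forall>n. \<exists>C.
     weakly_skew C \<and> circuit_poly C = f n \<and> length C \<le> poly p n}"

end

theory Submission
  imports Defs "HOL-Computational_Algebra.Formal_Power_Series"
begin

text \<open>
  A face of the Newton polytope singles out the perfect matchings of minimal weight for some real
  weight function. By Edmonds' description of the matching polytope this weight may be replaced by
  a sum of at most \<open>card E\<close> facet weights with values in \<open>{-1, 0, 1}\<close>, hence by integers of
  polynomial size. After a shift by a constant \<open>L\<close>, the restriction to the face becomes a single
  coefficient of the Pfaffian of \<open>J + A(t)\<close>, where \<open>J\<close> is the standard symplectic form and \<open>A(t)\<close>
  has the entries \<open>x\<^sub>e t\<^bsup>b(e) + L\<^esup>\<close>. Because \<open>J + A(t)\<close> is invertible over power series, eliminating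
  two rows at a time writes this Pfaffian as a product of factors which, like the row combinations
  \<open>z\<close> used for the elimination, satisfy linear recursions whose coefficients are entries of \<open>A(t)\<close>.
  Evaluating the recursions degree by degree multiplies only by input gates, so it is a skew circuit.
\<close>

section \<open>Matchings of maximal weight\<close>

text \<open>Two obstacles shape the proof. Real weights cannot be exponents of \<open>t\<close>, and
  the degree of the extracted coefficient enters the circuit size, so small integral weights have to
  come first. Weak skewness then forbids a product of two computed polynomials unless one of them
  comes from a subcircuit used nowhere else, whereas elimination reuses everything it computes.
  Division and the square root of a determinant are no way out, and the characteristic may be 2. The
  form \<open>J\<close> makes the linear systems of the elimination solvable by recursion on the
  degree in \<open>t\<close>, with no division. The product of the factors is never formed by
  multiplication either: the recursion of each elimination step is seeded with the Pfaffian of the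
  remaining rows, which is thereby carried along linearly. The price of \<open>J\<close> is that the
  Pfaffian acquires terms from matchings in which some edges are taken from \<open>J\<close>; the
  shift \<open>L\<close> exceeds the possible variation of the weights, so these terms end up in
  other degrees.\<close>

definition matchings :: "'a set set \<Rightarrow> 'a set set set" where
  "matchings E = {M. M \<subseteq> E \<and> disjoint M}"

definition max_matchings :: "'a set set \<Rightarrow> ('a set \<Rightarrow> real) \<Rightarrow> 'a set set set" where
  "max_matchings E w = {M \<in> matchings E. \<forall>M'\<in>matchings E. sum w M' \<le> sum w M}"

lemma matchings_disjoint: "M \<in> matchings E \<Longrightarrow> e \<in> M \<Longrightarrow> f \<in> M \<Longrightarrow> x \<in> e \<Longrightarrow> x \<in> f \<Longrightarrow> e = f"
  unfolding matchings_def disjoint_def by blast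

lemma matchings_subset: "M \<in> matchings E \<Longrightarrow> M' \<subseteq> M \<Longrightarrow> M' \<in> matchings E"
  by (auto simp: matchings_def intro: pairwise_subset)

lemma matchings_insert:
  "M \<in> matchings E \<Longrightarrow> e \<in> E \<Longrightarrow> e \<inter> \<Union>M = {} \<Longrightarrow> insert e M \<in> matchings E"
  by (auto simp: matchings_def pairwise_insert disjnt_def)

lemma finite_matchings: "finite E \<Longrightarrow> finite (matchings E)"
  by (rule finite_subset[of _ "Pow E"]) (auto simp: matchings_def)

lemma empty_matching: "{} \<in> matchings E"
  by (simp add: matchings_def)

lemma max_matchings_nonempty:
  assumes "finite E" shows "max_matchings E w \<noteq> {}"
proof -
  have "sum w ` matchings E \<noteq> {}" using empty_matching by blast
  then have "Max (sum w ` matchings E) \<in> sum w ` matchings E"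
    using finite_matchings[OF assms] by (intro Max_in) auto
  then obtain M where "M \<in> matchings E" "Max (sum w ` matchings E) = sum w M" by auto
  moreover have "sum w M' \<le> Max (sum w ` matchings E)" if "M' \<in> matchings E" for M'
    using finite_matchings[OF assms] that by auto
  ultimately show ?thesis by (auto simp: max_matchings_def)
qed

section \<open>Connected components of the union of two matchings\<close>

lemma card_Union_pairs:
  assumes "finite M" "disjoint M" "\<And>e. e \<in> M \<Longrightarrow> card e = 2"
  shows "card (\<Union>M) = 2 * card M"
proof -
  have "card (\<Union>M) = sum card M"
    using assms by (intro card_Union_disjoint) (auto intro: card_ge_0_finite)
  also have "\<dots> = 2 * card M" using assms(3) by simp
  finally show ?thesis .
qed

text \<open>A connected graph has at least as many edges as a spanning tree. Take a largest set
  around \<open>t\<close> that satisfies the bound: an edge leaving it would add one vertex and at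
  least one edge.\<close>

lemma card_component_le:
  fixes F :: "'a set set"
  assumes "finite F" "finite X"
    and X: "X = {x. (t, x) \<in> {(x, y). {x, y} \<in> F}\<^sup>*}"
  shows "card X \<le> card {e \<in> F. e \<subseteq> X} + 1"
proof -
  define R where "R = {(x, y). {x, y} \<in> F}"
  define \<Y> where "\<Y> = {Y. t \<in> Y \<and> Y \<subseteq> X \<and> card Y \<le> card {e \<in> F. e \<subseteq> Y} + 1}"
  have fin: "finite \<Y>" using \<open>finite X\<close> by (auto simp: \<Y>_def)
  have t: "t \<in> X" using X by auto
  have "{t} \<in> \<Y>" using t by (auto simp: \<Y>_def)
  then obtain Y where Y: "Y \<in> \<Y>" and max: "\<And>Y'. Y' \<in> \<Y> \<Longrightarrow> card Y' \<le> card Y"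
  proof -
    have "Max (card ` \<Y>) \<in> card ` \<Y>" using \<open>{t} \<in> \<Y>\<close> fin by (intro Max_in) auto
    then obtain Y where "Y \<in> \<Y>" "card Y = Max (card ` \<Y>)" by auto
    then show ?thesis using that fin by simp
  qed
  have "Y = X"
  proof (rule ccontr)
    assume "Y \<noteq> X"
    have "\<exists>x y. x \<in> Y \<and> y \<notin> Y \<and> {x, y} \<in> F"
    proof (rule ccontr)
      assume *: "\<not> ?thesis"
      have "z \<in> Y" if "(t, z) \<in> R\<^sup>*" for z using that
        by (induction rule: rtrancl_induct) (use * Y in \<open>auto simp: R_def \<Y>_def\<close>)
      then have "X \<subseteq> Y" using X R_def by auto
      then show False using \<open>Y \<noteq> X\<close> Y by (auto simp: \<Y>_def)
    qed
    then obtain x y where xy: "x \<in> Y" "y \<notin> Y" "{x, y} \<in> F" by blast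
    have "y \<in> X"
    proof -
      have "(t, x) \<in> R\<^sup>*" using xy Y X by (auto simp: \<Y>_def R_def)
      moreover have "(x, y) \<in> R" using xy by (simp add: R_def)
      ultimately show ?thesis using X by (auto simp: R_def intro: rtrancl_into_rtrancl)
    qed
    have finY: "finite Y" using Y \<open>finite X\<close> finite_subset by (auto simp: \<Y>_def)
    have "insert {x, y} {e \<in> F. e \<subseteq> Y} \<subseteq> {e \<in> F. e \<subseteq> insert y Y}" using xy by auto
    then have "card (insert {x, y} {e \<in> F. e \<subseteq> Y}) \<le> card {e \<in> F. e \<subseteq> insert y Y}"
      using \<open>finite F\<close> by (intro card_mono) auto
    moreover have "card (insert {x, y} {e \<in> F. e \<subseteq> Y}) = card {e \<in> F. e \<subseteq> Y} + 1"
      using \<open>finite F\<close> xy by (subst card_insert_disjoint) auto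
    ultimately have "card (insert y Y) \<le> card {e \<in> F. e \<subseteq> insert y Y} + 1"
      using Y xy finY by (auto simp: \<Y>_def)
    then have "insert y Y \<in> \<Y>" using Y \<open>y \<in> X\<close> by (auto simp: \<Y>_def)
    then have "card (insert y Y) \<le> card Y" by (rule max)
    then show False using xy finY by simp
  qed
  then show ?thesis using Y by (auto simp: \<Y>_def)
qed

text \<open>Swapping two optimal matchings on the component of \<open>t\<close> in their union. A component with
  three vertices of degree at most one would have too few edges to be connected.\<close>

lemma exchange:
  assumes fin: "finite E" and pairs: "\<forall>e\<in>E. card e = 2"
    and M: "M \<in> max_matchings E w" and N: "N \<in> max_matchings E w"
    and uv: "u \<noteq> v" "u \<notin> \<Union>M" "v \<notin> \<Union>M" and t: "t \<notin> \<Union>N"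
    and diff: "t \<noteq> u" "t \<noteq> v"
  shows "\<exists>M' \<in> max_matchings E w. M' \<subseteq> M \<union> N \<and> t \<notin> \<Union>M' \<and> (u \<notin> \<Union>M' \<or> v \<notin> \<Union>M')"
proof -
  have E2: "card e = 2" if "e \<in> E" for e using pairs that by blast
  define F where "F = M \<union> N"
  define X where "X = {x. (t, x) \<in> {(x, y). {x, y} \<in> F}\<^sup>*}"
  have MN: "M \<in> matchings E" "N \<in> matchings E" using M N by (auto simp: max_matchings_def)
  have FE: "F \<subseteq> E" using MN by (auto simp: F_def matchings_def)
  have finF: "finite F" using FE fin finite_subset by blast
  have finM: "finite M" "finite N" using finF by (auto simp: F_def)
  have tX: "t \<in> X" by (auto simp: X_def)
  have closed: "e \<subseteq> X" if "e \<in> F" "x \<in> e" "x \<in> X" for e x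
  proof
    fix y assume "y \<in> e"
    show "y \<in> X"
    proof (cases "x = y")
      case False
      have "card e = 2" using that FE E2 by auto
      then have "e = {x, y}" using \<open>x \<in> e\<close> \<open>y \<in> e\<close> False by (auto simp: card_2_iff)
      then have "(t, y) \<in> {(x, y). {x, y} \<in> F}\<^sup>*"
        using that by (auto simp: X_def intro: rtrancl_into_rtrancl)
      then show ?thesis by (simp add: X_def)
    qed (use that in auto)
  qed
  have fE: "finite e" if "e \<in> E" for e using E2[OF that] card_ge_0_finite[of e] by auto
  have finUF: "finite (\<Union>F)" using finF fE FE by auto
  have "X \<subseteq> insert t (\<Union>F)"
  proof
    fix x assume "x \<in> X"
    then have "(t, x) \<in> {(x, y). {x, y} \<in> F}\<^sup>*" by (simp add: X_def)
    then show "x \<in> insert t (\<Union>F)" by (induction rule: rtrancl_induct) auto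
  qed
  then have finX: "finite X" using finUF finite_subset by auto
  have not_both: "\<not> (u \<in> X \<and> v \<in> X)"
  proof
    assume uvX: "u \<in> X \<and> v \<in> X"
    have "card X \<le> card {e \<in> F. e \<subseteq> X} + 1"
      using card_component_le[OF finF finX X_def] .
    also have "{e \<in> F. e \<subseteq> X} = {e \<in> M. e \<subseteq> X} \<union> {e \<in> N. e \<subseteq> X}" by (auto simp: F_def)
    also have "card \<dots> \<le> card {e \<in> M. e \<subseteq> X} + card {e \<in> N. e \<subseteq> X}" by (rule card_Un_le)
    finally have 1: "card X \<le> card {e \<in> M. e \<subseteq> X} + card {e \<in> N. e \<subseteq> X} + 1" by simp
    have two: "2 * card {e \<in> L. e \<subseteq> X} = card (\<Union>{e \<in> L. e \<subseteq> X})" if "L = M \<or> L = N" for L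
    proof (rule card_Union_pairs[symmetric])
      show "finite {e \<in> L. e \<subseteq> X}" using that finM by auto
      show "disjoint {e \<in> L. e \<subseteq> X}"
        using that MN by (auto simp: matchings_def intro: pairwise_subset)
      show "card e = 2" if "e \<in> {e \<in> L. e \<subseteq> X}" for e
        using that \<open>L = M \<or> L = N\<close> E2 FE by (auto simp: F_def)
    qed
    have "card (\<Union>{e \<in> M. e \<subseteq> X}) \<le> card (X - {u, v})"
      using uv finX by (intro card_mono) auto
    also have "\<dots> = card X - 2" using uvX uv finX by (subst card_Diff_subset) auto
    finally have 2: "2 * card {e \<in> M. e \<subseteq> X} \<le> card X - 2" using two by simp
    have "card (\<Union>{e \<in> N. e \<subseteq> X}) \<le> card (X - {t})"
      using t finX by (intro card_mono) auto
    also have "\<dots> = card X - 1" using tX finX by simp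
    finally have 3: "2 * card {e \<in> N. e \<subseteq> X} \<le> card X - 1" using two by simp
    \<comment> \<open>With three vertices the truncated subtractions above are ordinary ones, and
      doubling 1 and inserting 2 and 3 gives \<open>2 * card X <= 2 * card X - 1\<close>.\<close>
    have "card {t, u, v} \<le> card X" using uvX tX finX by (intro card_mono) auto
    then have "3 \<le> card X" using uv diff by simp
    then show False using 1 2 3 by linarith
  qed
  define M' where "M' = {e \<in> M. \<not> e \<subseteq> X} \<union> {e \<in> N. e \<subseteq> X}"
  define N' where "N' = {e \<in> N. \<not> e \<subseteq> X} \<union> {e \<in> M. e \<subseteq> X}"
  \<comment> \<open>An edge of \<open>F\<close> that meets \<open>X\<close> lies inside
    \<open>X\<close>, so an edge kept outside cannot touch one exchanged inside.\<close>
  have glue: "{e \<in> A. \<not> e \<subseteq> X} \<union> {e \<in> B. e \<subseteq> X} \<in> matchings E"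
    if "A \<in> matchings E" "B \<in> matchings E" "A \<subseteq> F" "B \<subseteq> F" for A B
  proof -
    have "disjoint ({e \<in> A. \<not> e \<subseteq> X} \<union> {e \<in> B. e \<subseteq> X})"
    proof (rule disjointI, rule ccontr)
      fix e f assume e: "e \<in> {e \<in> A. \<not> e \<subseteq> X} \<union> {e \<in> B. e \<subseteq> X}"
        and f: "f \<in> {e \<in> A. \<not> e \<subseteq> X} \<union> {e \<in> B. e \<subseteq> X}" and ne: "e \<noteq> f" "e \<inter> f \<noteq> {}"
      obtain x where x: "x \<in> e" "x \<in> f" using ne by auto
      have "e \<subseteq> X \<longleftrightarrow> f \<subseteq> X" using closed[of e x] closed[of f x] x e f that by blast
      then have "e \<in> A \<and> f \<in> A \<or> e \<in> B \<and> f \<in> B" using e f by auto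
      then show False using matchings_disjoint that x ne by metis
    qed
    then show ?thesis using that by (auto simp: matchings_def)
  qed
  have M': "M' \<in> matchings E" and N': "N' \<in> matchings E"
    unfolding M'_def N'_def using glue MN by (auto simp: F_def)
  have weights: "sum w M' + sum w N' = sum w M + sum w N"
  proof -
    have "sum w M' = sum w {e \<in> M. \<not> e \<subseteq> X} + sum w {e \<in> N. e \<subseteq> X}"
      unfolding M'_def using finM by (intro sum.union_disjoint) auto
    moreover have "sum w N' = sum w {e \<in> N. \<not> e \<subseteq> X} + sum w {e \<in> M. e \<subseteq> X}"
      unfolding N'_def using finM by (intro sum.union_disjoint) auto
    moreover have split: "sum w {e \<in> L. \<not> e \<subseteq> X} + sum w {e \<in> L. e \<subseteq> X} = sum w L"
      if "finite L" for L
      using that by (subst sum.union_disjoint[symmetric]) (auto intro: sum.cong)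
    ultimately show ?thesis using split[OF finM(1)] split[OF finM(2)] by linarith
  qed
  \<comment> \<open>Neither new matching beats an optimal one and the totals agree, so both
    inequalities are equalities.\<close>
  have "sum w M' \<le> sum w M" "sum w N' \<le> sum w N"
    using M N M' N' by (auto simp: max_matchings_def)
  with weights have "sum w M' = sum w M" by linarith
  then have "M' \<in> max_matchings E w" using M M' by (auto simp: max_matchings_def)
  moreover have "M' \<subseteq> M \<union> N" by (auto simp: M'_def)
  moreover have "t \<notin> \<Union>M'"
    using t closed tX by (auto simp: M'_def F_def)
  moreover have "u \<notin> \<Union>M' \<or> v \<notin> \<Union>M'" using not_both uv by (auto simp: M'_def)
  ultimately show ?thesis by (intro bexI conjI)
qed

section \<open>Optimality criteria and Edmonds' facets\<close>

lemma max_matchings_cong: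
  assumes "\<And>e. e \<in> E \<Longrightarrow> w e = w' e"
  shows "max_matchings E w = max_matchings E w'"
proof -
  have "sum w M = sum w' M" if "M \<in> matchings E" for M
    using that assms by (intro sum.cong) (auto simp: matchings_def)
  then show ?thesis by (auto simp: max_matchings_def)
qed

lemma max_matchingsI:
  "M \<in> matchings E \<Longrightarrow> (\<And>M'. M' \<in> matchings E \<Longrightarrow> sum w M' \<le> sum w M) \<Longrightarrow> M \<in> max_matchings E w"
  by (simp add: max_matchings_def)

lemma max_matchingsD:
  assumes "M \<in> max_matchings E w"
  shows "M \<in> matchings E" "M' \<in> matchings E \<Longrightarrow> sum w M' \<le> sum w M"
  using assms by (simp_all add: max_matchings_def)

lemma max_matchings_value:
  assumes "M \<in> max_matchings E w" "M' \<in> max_matchings E w"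
  shows "sum w M = sum w M'"
  using max_matchingsD(2)[OF assms(1) max_matchingsD(1)[OF assms(2)]]
    max_matchingsD(2)[OF assms(2) max_matchingsD(1)[OF assms(1)]] by simp

lemma max_matchings_iff:
  assumes "M0 \<in> max_matchings E w"
  shows "M \<in> max_matchings E w \<longleftrightarrow> M \<in> matchings E \<and> sum w M = sum w M0"
proof
  assume "M \<in> max_matchings E w"
  then show "M \<in> matchings E \<and> sum w M = sum w M0"
    using max_matchings_value[OF _ assms] max_matchingsD(1) by blast
next
  assume M: "M \<in> matchings E \<and> sum w M = sum w M0"
  show "M \<in> max_matchings E w"
    by (rule max_matchingsI) (use M max_matchingsD(2)[OF assms] in auto)
qed

text \<open>Lovasz's argument. If every edge lies in some optimal matching and every vertex is missed by
  some optimal matching, then ``no optimal matching of positive edges misses both \<open>u\<close> and \<open>v\<close>'' is an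
  equivalence relation, by the exchange lemma. A class \<open>S\<close> with a positive edge is odd, and every
  optimal matching has \<open>(card S - 1) / 2\<close> edges inside \<open>S\<close>.\<close>

lemma max_matchings_facet:
  fixes E :: "'a set set"
  assumes fin: "finite E" and pairs: "\<forall>e\<in>E. card e = 2"
    and nontrivial: "max_matchings E w \<noteq> matchings E"
  obtains a :: "'a set \<Rightarrow> int"
  where "\<And>e. \<bar>a e\<bar> \<le> 1" "max_matchings E w \<subseteq> max_matchings E (\<lambda>e. a e)"
    "max_matchings E (\<lambda>e. a e) \<noteq> matchings E"
proof -
  have E2: "card e = 2" if "e \<in> E" for e using pairs that by blast
  let ?O = "max_matchings E w"
  have finM: "finite M" if "M \<in> matchings E" for M
    using that fin finite_subset by (auto simp: matchings_def)
  have OM: "M \<in> matchings E" if "M \<in> ?O" for M using that by (simp add: max_matchings_def)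
  have single: "{e} \<in> matchings E" if "e \<in> E" for e using that by (simp add: matchings_def)
  \<comment> \<open>The cases match the three families of Edmonds' inequalities: an edge variable is
    nonnegative, a vertex has at most one edge, an odd set \<open>S\<close> contains at most
    \<open>(card S - 1) / 2\<close> edges.\<close>
  consider (unused) e where "e \<in> E" "\<forall>M\<in>?O. e \<notin> M"
    | (covered) v where "v \<in> \<Union>E" "\<forall>M\<in>?O. v \<in> \<Union>M"
    | (other) "\<forall>e\<in>E. \<exists>M\<in>?O. e \<in> M" "\<forall>v\<in>\<Union>E. \<exists>M\<in>?O. v \<notin> \<Union>M"
    by (meson)
  then show thesis
  proof cases
    case unused
    define a :: "'a set \<Rightarrow> int" where "a = (\<lambda>f. if f = e then -1 else 0)"
    have val: "(\<Sum>f\<in>M. real_of_int (a f)) = (if e \<in> M then -1 else 0)" if "M \<in> matchings E" for M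
    proof -
      have "(\<Sum>f\<in>M. real_of_int (a f)) = (\<Sum>f\<in>M. if f = e then - 1 else 0)"
        by (intro sum.cong) (auto simp: a_def)
      then show ?thesis using finM[OF that] by (simp add: sum.delta')
    qed
    show ?thesis
    proof (rule that)
      show "\<bar>a f\<bar> \<le> 1" for f by (simp add: a_def)
      show "?O \<subseteq> max_matchings E (\<lambda>e. a e)"
      proof
        fix M assume M: "M \<in> ?O"
        show "M \<in> max_matchings E (\<lambda>e. a e)"
        proof (rule max_matchingsI[OF OM[OF M]])
          fix M' assume M': "M' \<in> matchings E"
          show "(\<Sum>f\<in>M'. real_of_int (a f)) \<le> (\<Sum>f\<in>M. real_of_int (a f))"
            using bspec[OF unused(2) M] unfolding val[OF OM[OF M]] val[OF M'] by simp
        qed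
      qed
      have "{e} \<notin> max_matchings E (\<lambda>e. a e)"
      proof
        assume "{e} \<in> max_matchings E (\<lambda>e. a e)"
        from max_matchingsD(2)[OF this empty_matching] show False by (simp add: a_def)
      qed
      then show "max_matchings E (\<lambda>e. a e) \<noteq> matchings E" using single[OF unused(1)] by blast
    qed
  next
    case covered
    define a :: "'a set \<Rightarrow> int" where "a = (\<lambda>f. if v \<in> f then 1 else 0)"
    have val: "(\<Sum>f\<in>M. real_of_int (a f)) = (if v \<in> \<Union>M then 1 else 0)" if M: "M \<in> matchings E" for M
    proof (cases "v \<in> \<Union>M")
      case True
      then obtain e where e: "e \<in> M" "v \<in> e" by auto
      have "v \<in> f \<longleftrightarrow> f = e" if "f \<in> M" for f
        using matchings_disjoint[OF M that e(1) _ e(2)] e(2) by blast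
      then have "(\<Sum>f\<in>M. real_of_int (a f)) = (\<Sum>f\<in>M. if f = e then 1 else 0)"
        by (intro sum.cong refl) (simp add: a_def)
      moreover have "v \<in> \<Union>M" using e by blast
      ultimately show ?thesis using finM[OF that] e by (simp add: sum.delta')
    next
      case False
      then have "a f = 0" if "f \<in> M" for f using that by (auto simp: a_def)
      then have "(\<Sum>f\<in>M. real_of_int (a f)) = 0" by simp
      then show ?thesis using False by simp
    qed
    show ?thesis
    proof (rule that)
      show "\<bar>a f\<bar> \<le> 1" for f by (simp add: a_def)
      show "?O \<subseteq> max_matchings E (\<lambda>e. a e)"
      proof
        fix M assume M: "M \<in> ?O"
        show "M \<in> max_matchings E (\<lambda>e. a e)"
        proof (rule max_matchingsI[OF OM[OF M]])
          fix M' assume M': "M' \<in> matchings E"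
          show "(\<Sum>f\<in>M'. real_of_int (a f)) \<le> (\<Sum>f\<in>M. real_of_int (a f))"
            using bspec[OF covered(2) M] unfolding val[OF OM[OF M]] val[OF M'] by simp
        qed
      qed
      obtain e where e: "e \<in> E" "v \<in> e" using covered by auto
      have "{} \<notin> max_matchings E (\<lambda>e. a e)"
      proof
        assume "{} \<in> max_matchings E (\<lambda>e. a e)"
        from max_matchingsD(2)[OF this single[OF e(1)]] show False using e by (simp add: a_def)
      qed
      then show "max_matchings E (\<lambda>e. a e) \<noteq> matchings E" using empty_matching by blast
    qed
  next
    case other
    \<comment> \<open>Removing an edge of negative weight would improve an optimal matching that
      contains it.\<close>
    have w_nonneg: "w e \<ge> 0" if "e \<in> E" for e
    proof -
      from other(1) that have "\<exists>M\<in>?O. e \<in> M" by (rule bspec)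
      then obtain M where M: "M \<in> ?O" "e \<in> M" by (rule bexE)
      have "M - {e} \<in> matchings E" using OM[OF M(1)] matchings_subset by blast
      then have "sum w (M - {e}) \<le> sum w M" using M by (auto simp: max_matchings_def)
      moreover have "sum w M = w e + sum w (M - {e})"
        using M finM[OF OM[OF M(1)]] by (simp add: sum.remove)
      ultimately show ?thesis by simp
    qed
    define P where "P = {e \<in> E. w e > 0}"
    \<comment> \<open>Zero-weight edges are discarded so that adding an edge to a matching of
      \<open>N\<close> is a strict gain; this is why the two ends of an edge of \<open>P\<close> are
      related below.\<close>
    define N where "N = {M \<in> ?O. M \<subseteq> P}"
    have restr: "M \<inter> P \<in> N" if "M \<in> ?O" for M
    proof -
      have "sum w (M \<inter> P) = sum w M"
        using OM[OF that] finM[OF OM[OF that]] w_nonneg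
        by (intro sum.mono_neutral_left) (force simp: P_def matchings_def)+
      moreover have "M \<inter> P \<in> matchings E" using OM[OF that] matchings_subset by blast
      ultimately show ?thesis using that by (auto simp: N_def max_matchings_def)
    qed
    have NO: "M \<in> ?O" if "M \<in> N" for M using that by (simp add: N_def)
    have NP: "M \<subseteq> P" if "M \<in> N" for M using that by (simp add: N_def)
    define miss where "miss M v \<longleftrightarrow> v \<notin> \<Union>M" for M :: "'a set set" and v
    have missed: "\<exists>M\<in>N. miss M v" for v
    proof (cases "v \<in> \<Union>E")
      case True
      from other(2) True have "\<exists>M\<in>?O. v \<notin> \<Union>M" by (rule bspec)
      then obtain M where M: "M \<in> ?O" "v \<notin> \<Union>M" by (rule bexE)
      show ?thesis by (rule bexI[OF _ restr[OF M(1)]]) (use M in \<open>auto simp: miss_def\<close>)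
    next
      case False
      obtain M where M: "M \<in> ?O" using max_matchings_nonempty[OF fin, of w] by (meson ex_in_conv)
      show ?thesis by (rule bexI[OF _ restr[OF M]]) (use False in \<open>auto simp: miss_def P_def\<close>)
    qed
    define rel where "rel u v \<longleftrightarrow> u = v \<or> (\<forall>M\<in>N. \<not> miss M u \<or> \<not> miss M v)" for u v
    have rel_trans: "rel u v" if "rel u t" "rel t v" for u t v
    proof (rule ccontr)
      assume "\<not> rel u v"
      then obtain M where M: "M \<in> N" "miss M u" "miss M v" and uv: "u \<noteq> v"
        by (auto simp: rel_def)
      have tu: "t \<noteq> u" "t \<noteq> v" using that \<open>\<not> rel u v\<close> by metis+
      obtain L where L: "L \<in> N" "miss L t" using missed by blast
      \<comment> \<open>A matching that misses \<open>t\<close> together with \<open>u\<close> or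
        \<open>v\<close> contradicts \<open>rel u t\<close> or \<open>rel t v\<close>. It consists
        of positive edges because \<open>M\<close> and \<open>L\<close> do.\<close>
      have "\<exists>M'\<in>?O. M' \<subseteq> M \<union> L \<and> t \<notin> \<Union>M' \<and> (u \<notin> \<Union>M' \<or> v \<notin> \<Union>M')"
        using M L by (intro exchange[OF fin pairs NO[OF M(1)] NO[OF L(1)] uv _ _ _ tu])
          (simp_all add: miss_def)
      then obtain M' where M': "M' \<in> ?O" "M' \<subseteq> M \<union> L" "miss M' t" "miss M' u \<or> miss M' v"
        unfolding miss_def by (elim bexE conjE)
      have "M' \<subseteq> P" using M'(2) NP[OF M(1)] NP[OF L(1)] by (meson Un_least order_trans)
      then have "M' \<in> N" using M'(1) by (simp add: N_def)
      then show False using M'(3,4) that tu unfolding rel_def by metis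
    qed
    have rel_edge: "rel x y" if "{x, y} \<in> P" for x y
    proof (rule ccontr)
      assume "\<not> rel x y"
      then obtain M where M: "M \<in> N" "miss M x" "miss M y" by (auto simp: rel_def)
      have MM: "M \<in> matchings E" using OM NO M by blast
      have "insert {x, y} M \<in> matchings E"
        using that M MM by (intro matchings_insert) (auto simp: P_def miss_def)
      then have "sum w (insert {x, y} M) \<le> sum w M"
        using max_matchingsD(2)[OF NO[OF M(1)]] by blast
      moreover have "{x, y} \<notin> M" using M by (auto simp: miss_def)
      then have "sum w (insert {x, y} M) = w {x, y} + sum w M"
        using finM[OF MM] by (intro sum.insert)
      ultimately show False using that by (simp add: P_def)
    qed
    have "P \<noteq> {}"
    proof
      assume "P = {}"
      then have w0: "w e = 0" if "e \<in> E" for e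
        using that w_nonneg[OF that] \<open>P = {}\<close> unfolding P_def by (metis (mono_tags, lifting) empty_Collect_eq order_le_less)
      have "sum w M = 0" if "M \<in> matchings E" for M
        using that w0 by (intro sum.neutral) (auto simp: matchings_def)
      then show False using nontrivial by (auto simp: max_matchings_def)
    qed
    then obtain e0 where e0: "e0 \<in> P" by blast
    then obtain u0 v0 where uv0: "e0 = {u0, v0}" using E2[of e0] by (auto simp: P_def card_2_iff)
    define S where "S = {v. rel u0 v}"
    have u0S: "u0 \<in> S" by (simp add: S_def rel_def)
    have P_closed: "e \<subseteq> S" if e: "e \<in> P" "x \<in> e" "x \<in> S" for e x
    proof
      fix y assume "y \<in> e"
      show "y \<in> S"
      proof (cases "x = y")
        case False
        have "e = {x, y}" using e \<open>y \<in> e\<close> False E2[of e] by (auto simp: P_def card_2_iff)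
        then have "rel x y" using rel_edge e by simp
        then show ?thesis using e rel_trans unfolding S_def by blast
      qed (use e in simp)
    qed
    have "S \<subseteq> \<Union>E"
    proof
      fix v assume v: "v \<in> S"
      obtain M where M: "M \<in> N" "miss M u0" using missed by blast
      show "v \<in> \<Union>E"
      proof (cases "v = u0")
        case True then show ?thesis using uv0 e0 by (auto simp: P_def)
      next
        case False
        then have "\<not> miss M v" using v M unfolding S_def rel_def by blast
        then show ?thesis using NP[OF M(1)] unfolding miss_def P_def by fast
      qed
    qed
    moreover have "finite (\<Union>E)" using fin E2 by (metis card.infinite finite_Union zero_neq_numeral)
    ultimately have finS: "finite S" using finite_subset by blast
    define a :: "'a set \<Rightarrow> int" where "a = (\<lambda>e. if e \<subseteq> S then 1 else 0)"
    define c where "c M = card {e \<in> M. e \<subseteq> S}" for M :: "'a set set"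
    have val: "(\<Sum>e\<in>M. real_of_int (a e)) = c M" if M: "M \<in> matchings E" for M
    proof -
      have "(\<Sum>e\<in>M. real_of_int (a e)) = (\<Sum>e\<in>{e \<in> M. e \<subseteq> S}. 1)"
        using finM[OF M] by (intro sum.mono_neutral_cong_right) (auto simp: a_def)
      then show ?thesis by (simp add: c_def)
    qed
    have card_c: "card (\<Union>{e \<in> M. e \<subseteq> S}) = 2 * c M" if M: "M \<in> matchings E" for M
      unfolding c_def
    proof (rule card_Union_pairs)
      show "finite {e \<in> M. e \<subseteq> S}" using finM[OF M] by simp
      show "disjoint {e \<in> M. e \<subseteq> S}" using M by (auto simp: matchings_def intro: pairwise_subset)
      show "card e = 2" if "e \<in> {e \<in> M. e \<subseteq> S}" for e using that E2 M by (auto simp: matchings_def)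
    qed
    have upper: "2 * c M \<le> card S" if M: "M \<in> matchings E" for M
    proof -
      have "card (\<Union>{e \<in> M. e \<subseteq> S}) \<le> card S" using finS by (intro card_mono) auto
      then show ?thesis using card_c[OF M] by simp
    qed
    have lower: "card S \<le> 2 * c M + 1" if M: "M \<in> ?O" for M
    proof -
      have "M \<inter> P \<in> N" by (rule restr[OF M])
      \<comment> \<open>Two vertices of the class \<open>S\<close> missed by one matching of
        \<open>N\<close> are related, hence equal. By \<open>P_closed\<close> all other vertices of
        \<open>S\<close> lie on edges of \<open>M\<close> inside \<open>S\<close>.\<close>
      have covered: "S - \<Union>(M \<inter> P) \<subseteq> {v}" if v: "v \<in> S - \<Union>(M \<inter> P)" for v
      proof
        fix x assume x: "x \<in> S - \<Union>(M \<inter> P)"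
        have "rel v x"
          using v x rel_trans[of v u0 x] unfolding S_def rel_def mem_Collect_eq Diff_iff by metis
        moreover have "miss (M \<inter> P) v" "miss (M \<inter> P) x" using v x by (simp_all add: miss_def)
        ultimately show "x \<in> {v}" using \<open>M \<inter> P \<in> N\<close> unfolding rel_def by blast
      qed
      have "card (S - \<Union>(M \<inter> P)) \<le> 1"
      proof (cases "S - \<Union>(M \<inter> P) = {}")
        case False
        then obtain v where "v \<in> S - \<Union>(M \<inter> P)" by blast
        then have "card (S - \<Union>(M \<inter> P)) \<le> card {v}" using covered by (intro card_mono) auto
        then show ?thesis by simp
      next
        case True
        show ?thesis unfolding True by simp
      qed
      moreover have "S \<subseteq> (S - \<Union>(M \<inter> P)) \<union> \<Union>{e \<in> M. e \<subseteq> S}"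
        using P_closed by blast
      then have "card S \<le> card ((S - \<Union>(M \<inter> P)) \<union> \<Union>{e \<in> M. e \<subseteq> S})"
        using finS by (intro card_mono) (auto intro: finite_subset[OF _ finS])
      moreover have "card ((S - \<Union>(M \<inter> P)) \<union> \<Union>{e \<in> M. e \<subseteq> S})
        \<le> card (S - \<Union>(M \<inter> P)) + card (\<Union>{e \<in> M. e \<subseteq> S})" by (rule card_Un_le)
      ultimately show ?thesis using card_c[OF OM[OF M]] by linarith
    qed
    \<comment> \<open>A matching of \<open>N\<close> that misses \<open>u0\<close> leaves a vertex
      of \<open>S\<close> uncovered, so \<open>lower\<close> forces
      \<open>card S = 2 * c L + 1\<close>. Parity then makes \<open>upper\<close> strict for every
      matching.\<close>
    have odd: "2 * c M < card S" if M: "M \<in> matchings E" for M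
    proof -
      obtain L where L: "L \<in> N" "miss L u0" using missed by blast
      have LM: "L \<in> matchings E" using OM NO L by blast
      have "2 * c L = card (\<Union>{e \<in> L. e \<subseteq> S})" using card_c[OF LM] by simp
      also have "\<dots> \<le> card (S - {u0})" using L finS by (intro card_mono) (auto simp: miss_def)
      also have "\<dots> < card S" using u0S finS by (intro psubset_card_mono) auto
      finally have "2 * c L < card S" .
      then have "card S = 2 * c L + 1" using lower[OF NO[OF L(1)]] by simp
      then show ?thesis using upper[OF M] by presburger
    qed
    show ?thesis
    proof (rule that)
      show "\<bar>a f\<bar> \<le> 1" for f by (simp add: a_def)
      show "?O \<subseteq> max_matchings E (\<lambda>e. a e)"
      proof
        fix M assume M: "M \<in> ?O"
        show "M \<in> max_matchings E (\<lambda>e. a e)"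
        proof (rule max_matchingsI[OF OM[OF M]])
          fix M' assume M': "M' \<in> matchings E"
          have "c M' \<le> c M" using lower[OF M] odd[OF M'] by linarith
          then show "(\<Sum>f\<in>M'. real_of_int (a f)) \<le> (\<Sum>f\<in>M. real_of_int (a f))"
            unfolding val[OF OM[OF M]] val[OF M'] by simp
        qed
      qed
      have "e0 \<subseteq> S" using P_closed[OF e0, of u0] u0S uv0 by simp
      have "e0 \<in> E" using e0 by (simp add: P_def)
      have "{} \<notin> max_matchings E (\<lambda>e. a e)"
      proof
        assume "{} \<in> max_matchings E (\<lambda>e. a e)"
        from max_matchingsD(2)[OF this single[OF \<open>e0 \<in> E\<close>]] show False
          using \<open>e0 \<subseteq> S\<close> by (simp add: a_def)
      qed
      then show "max_matchings E (\<lambda>e. a e) \<noteq> matchings E" using empty_matching by blast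
    qed
  qed
qed

section \<open>Integral weights cutting out a face\<close>

lemma lookup_scaleR [simp]:
  "Poly_Mapping.lookup (c *\<^sub>R f) i = c * Poly_Mapping.lookup (f :: 'b \<Rightarrow>\<^sub>0 real) i"
proof -
  have "finite {i. c *\<^sub>R Poly_Mapping.lookup f i \<noteq> 0}"
    by (rule finite_subset[OF _ finite_lookup[of f]]) auto
  then show ?thesis by (simp add: scaleR_poly_mapping_def Abs_poly_mapping_inverse)
qed

text \<open>Subtracting the largest multiple of a facet weight under which the optimal matchings stay
  optimal makes a further matching optimal; the facet weights met on the way are linearly
  independent, since each is constant on all later faces but not on its own.\<close>

lemma max_matchings_facets:
  fixes E :: "'a set set"
  assumes fin: "finite E" and pairs: "\<forall>e\<in>E. card e = 2"
  shows "\<exists>B :: ('a set \<Rightarrow>\<^sub>0 real) set. independent B \<and> B \<subseteq> span ((\<lambda>e. Poly_Mapping.single e 1) ` E)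
    \<and> (\<forall>b\<in>B. \<forall>e. Poly_Mapping.lookup b e \<in> \<int> \<and> \<bar>Poly_Mapping.lookup b e\<bar> \<le> 1)
    \<and> max_matchings E w = {M \<in> matchings E. \<forall>b\<in>B. M \<in> max_matchings E (Poly_Mapping.lookup b)}"
proof (induction "card (matchings E - max_matchings E w)" arbitrary: w rule: less_induct)
  case less
  let ?O = "max_matchings E w"
  show ?case
  proof (cases "?O = matchings E")
    case True
    then show ?thesis by (intro exI[of _ "{}"]) (simp add: independent_empty)
  next
    case False
    obtain a :: "'a set \<Rightarrow> int" where a1: "\<And>e. \<bar>a e\<bar> \<le> 1"
      and aO: "?O \<subseteq> max_matchings E (\<lambda>e. a e)" and anon: "max_matchings E (\<lambda>e. a e) \<noteq> matchings E"
      using max_matchings_facet[OF fin pairs False] by blast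
    define f where "f e = real_of_int (a e)" for e
    have fO: "?O \<subseteq> max_matchings E f" and fnon: "max_matchings E f \<noteq> matchings E"
      using aO anon by (simp_all add: f_def[abs_def])
    obtain M0 where M0: "M0 \<in> ?O" using max_matchings_nonempty[OF fin, of w] by (meson ex_in_conv)
    have M0f: "M0 \<in> max_matchings E f" using M0 fO by (rule subsetD[rotated])
    define gw where "gw M = sum w M0 - sum w M" for M
    define gf where "gf M = sum f M0 - sum f M" for M
    have gw0: "gw M \<ge> 0" if "M \<in> matchings E" for M
      using max_matchingsD(2)[OF M0 that] by (simp add: gw_def)
    have gf0: "gf M \<ge> 0" if "M \<in> matchings E" for M
      using max_matchingsD(2)[OF M0f that] by (simp add: gf_def)
    have Ow: "M \<in> ?O \<longleftrightarrow> M \<in> matchings E \<and> gw M = 0" for M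
      unfolding max_matchings_iff[OF M0] gw_def by auto
    have Of: "M \<in> max_matchings E f \<longleftrightarrow> M \<in> matchings E \<and> gf M = 0" for M
      unfolding max_matchings_iff[OF M0f] gf_def by auto
    define Z where "Z = {M \<in> matchings E. gf M > 0}"
    have "finite Z" using finite_matchings[OF fin] by (simp add: Z_def)
    have "Z \<noteq> {}"
    proof
      assume "Z = {}"
      then have "gf M = 0" if "M \<in> matchings E" for M
        using gf0[OF that] that by (force simp: Z_def)
      then have "max_matchings E f = matchings E" using Of by blast
      then show False using fnon by simp
    qed
    \<comment> \<open>Ratio test: \<open>T\<close> is the largest factor for which the maximizers of
      \<open>w\<close> stay optimal for \<open>w - T * f\<close>. A matching \<open>M1\<close> that
      attains it becomes optimal without being optimal for \<open>f\<close>.\<close>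
    define T where "T = Min ((\<lambda>M. gw M / gf M) ` Z)"
    have "T \<in> (\<lambda>M. gw M / gf M) ` Z" unfolding T_def using \<open>finite Z\<close> \<open>Z \<noteq> {}\<close> by (intro Min_in) auto
    then obtain M1 where M1: "M1 \<in> Z" "T = gw M1 / gf M1" by auto
    have Tle: "T * gf M \<le> gw M" if "M \<in> matchings E" for M
    proof (cases "M \<in> Z")
      case True
      then have "T \<le> gw M / gf M" unfolding T_def using \<open>finite Z\<close> by (intro Min_le) auto
      then show ?thesis using True by (simp add: Z_def pos_le_divide_eq)
    next
      case False
      then have "gf M = 0" using gf0[OF that] that by (auto simp: Z_def)
      then show ?thesis using gw0[OF that] by simp
    qed
    define w' where "w' e = w e - T * f e" for e
    have sumw': "sum w' M0 - sum w' M = gw M - T * gf M" for M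
      by (simp add: w'_def gw_def gf_def sum_subtractf sum_distrib_left algebra_simps)
    have M0w': "M0 \<in> max_matchings E w'"
      by (rule max_matchingsI[OF max_matchingsD(1)[OF M0]]) (use sumw' Tle in \<open>smt (verit)\<close>)
    have Ow': "M \<in> max_matchings E w' \<longleftrightarrow> M \<in> matchings E \<and> gw M = T * gf M" for M
      using sumw'[of M] unfolding max_matchings_iff[OF M0w'] by auto
    have M1w': "M1 \<in> max_matchings E w'" using M1 by (simp add: Ow' Z_def)
    have M1f: "M1 \<notin> max_matchings E f" using M1 by (simp add: Of Z_def)
    have OO: "M \<in> ?O \<longleftrightarrow> M \<in> max_matchings E w' \<and> M \<in> max_matchings E f" for M
      using subsetD[OF fO, of M] unfolding Ow Ow' Of by auto
    have "matchings E - max_matchings E w' \<subset> matchings E - ?O"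
    proof
      show "matchings E - max_matchings E w' \<subseteq> matchings E - ?O" using OO by blast
      have "M1 \<in> matchings E - ?O" using M1 M1f OO by (auto simp: Z_def)
      then show "matchings E - max_matchings E w' \<noteq> matchings E - ?O" using M1w' by blast
    qed
    then have "card (matchings E - max_matchings E w') < card (matchings E - ?O)"
      using finite_matchings[OF fin] by (intro psubset_card_mono) auto
    from less[OF this] obtain B :: "('a set \<Rightarrow>\<^sub>0 real) set" where B: "independent B"
      "B \<subseteq> span ((\<lambda>e. Poly_Mapping.single e 1) ` E)"
      "\<forall>b\<in>B. \<forall>e. Poly_Mapping.lookup b e \<in> \<int> \<and> \<bar>Poly_Mapping.lookup b e\<bar> \<le> 1"
      "max_matchings E w' = {M \<in> matchings E. \<forall>b\<in>B. M \<in> max_matchings E (Poly_Mapping.lookup b)}"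
      by (elim exE conjE)
    define v where "v = (\<Sum>e\<in>E. f e *\<^sub>R Poly_Mapping.single e (1::real))"
    have lookup_v: "Poly_Mapping.lookup v e = (if e \<in> E then f e else 0)" for e
    proof -
      have "Poly_Mapping.lookup v e = (\<Sum>e'\<in>E. if e' = e then f e' else 0)"
        unfolding v_def lookup_sum by (intro sum.cong) (auto simp: lookup_single when_def)
      then show ?thesis using fin by (simp add: sum.delta')
    qed
    have max_v: "max_matchings E (Poly_Mapping.lookup v) = max_matchings E f"
      by (rule max_matchings_cong) (simp add: lookup_v)
    \<comment> \<open>Every weight in \<open>B\<close> is constant on the maximizers of
      \<open>w'\<close>, among them \<open>M0\<close> and \<open>M1\<close>, and constancy passes to
      the span. The new facet weight \<open>v\<close> separates these two matchings.\<close>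
    have const: "sum (Poly_Mapping.lookup b) M0 = sum (Poly_Mapping.lookup b) M1" if "b \<in> span B" for b
      using that
    proof (induction rule: span_induct_alt)
      case base
      show ?case by simp
    next
      case (step c x y)
      have "M0 \<in> max_matchings E (Poly_Mapping.lookup x)" "M1 \<in> max_matchings E (Poly_Mapping.lookup x)"
        using M0w' M1w' step(1) unfolding B(4) by auto
      then have "sum (Poly_Mapping.lookup x) M0 = sum (Poly_Mapping.lookup x) M1"
        by (rule max_matchings_value)
      then show ?case using step(2) by (simp add: lookup_add sum.distrib flip: sum_distrib_left)
    qed
    have "v \<notin> span B"
    proof
      assume "v \<in> span B"
      then have "sum (Poly_Mapping.lookup v) M0 = sum (Poly_Mapping.lookup v) M1" by (rule const)
      moreover have "M1 \<in> matchings E" using M1 by (simp add: Z_def)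
      moreover have "M0 \<in> max_matchings E (Poly_Mapping.lookup v)" using M0f max_v by simp
      ultimately have "M1 \<in> max_matchings E (Poly_Mapping.lookup v)"
        using max_matchings_iff by metis
      then show False using M1f max_v by simp
    qed
    show ?thesis
    proof (intro exI[of _ "insert v B"] conjI ballI allI)
      show "independent (insert v B)" using \<open>v \<notin> span B\<close> B(1) by (rule independent_insertI)
      have "v \<in> span ((\<lambda>e. Poly_Mapping.single e 1) ` E)"
        unfolding v_def by (intro span_sum span_scale span_base) auto
      then show "insert v B \<subseteq> span ((\<lambda>e. Poly_Mapping.single e 1) ` E)" using B(2) by simp
      fix b e assume b: "b \<in> insert v B"
      have "\<bar>f e\<bar> \<le> 1" using a1[of e] by (simp add: f_def flip: of_int_abs)
      then show "Poly_Mapping.lookup b e \<in> \<int>" "\<bar>Poly_Mapping.lookup b e\<bar> \<le> 1"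
        using b B(3) by (auto simp: lookup_v f_def)
    next
      show "?O = {M \<in> matchings E. \<forall>b\<in>insert v B. M \<in> max_matchings E (Poly_Mapping.lookup b)}"
      proof (rule set_eqI)
        fix M
        show "M \<in> ?O \<longleftrightarrow> M \<in> {M \<in> matchings E. \<forall>b\<in>insert v B. M \<in> max_matchings E (Poly_Mapping.lookup b)}"
          unfolding OO B(4) mem_Collect_eq ball_simps max_v by (simp only: conj_ac)
      qed
    qed
  qed
qed

text \<open>Weights with a common maximizer can be added: a matching is optimal for the sum iff it
  is optimal for each summand, as a deficit in one cannot be made up by another. The number of
  summands is bounded by the dimension \<open>card E\<close>, and each has absolute values at most
  1.\<close>

lemma max_matchings_integral_weight:
  fixes E :: "'a set set"
  assumes fin: "finite E" and pairs: "\<forall>e\<in>E. card e = 2"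
  obtains b :: "'a set \<Rightarrow> int"
  where "\<And>e. \<bar>b e\<bar> \<le> int (card E)" "max_matchings E w = max_matchings E (\<lambda>e. b e)"
proof -
  obtain B :: "('a set \<Rightarrow>\<^sub>0 real) set" where B: "independent B"
      "B \<subseteq> span ((\<lambda>e. Poly_Mapping.single e 1) ` E)"
      "\<forall>b\<in>B. \<forall>e. Poly_Mapping.lookup b e \<in> \<int> \<and> \<bar>Poly_Mapping.lookup b e\<bar> \<le> 1"
      "max_matchings E w = {M \<in> matchings E. \<forall>b\<in>B. M \<in> max_matchings E (Poly_Mapping.lookup b)}"
    using max_matchings_facets[OF fin pairs, of w] by (elim exE conjE)
  have "finite B \<and> card B \<le> card ((\<lambda>e. Poly_Mapping.single e (1::real)) ` E)"
    using fin B(1,2) by (intro independent_span_bound) auto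
  then have finB: "finite B" and cardB: "card B \<le> card E"
    using card_image_le[OF fin] order_trans by blast+
  define h where "h e = (\<Sum>b\<in>B. Poly_Mapping.lookup b e)" for e
  have "h e \<in> \<int>" for e unfolding h_def using B(3) by (intro Ints_sum) blast
  then have hfl: "real_of_int \<lfloor>h e\<rfloor> = h e" for e by (simp add: of_int_floor_cancel)
  have "\<bar>h e\<bar> \<le> card E" for e
  proof -
    have "\<bar>h e\<bar> \<le> (\<Sum>b\<in>B. \<bar>Poly_Mapping.lookup b e\<bar>)" unfolding h_def by (rule sum_abs)
    also have "\<dots> \<le> (\<Sum>b\<in>B. 1)" using B(3) by (intro sum_mono) blast
    also have "\<dots> \<le> card E" using cardB by simp
    finally show ?thesis .
  qed
  then have hb: "\<bar>\<lfloor>h e\<rfloor>\<bar> \<le> int (card E)" for e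
    using hfl[of e] by (metis of_int_abs of_int_le_iff of_int_of_nat_eq)
  obtain M0 where M0: "M0 \<in> max_matchings E w" using max_matchings_nonempty[OF fin, of w] by (meson ex_in_conv)
  have M0b: "M0 \<in> max_matchings E (Poly_Mapping.lookup b)" if "b \<in> B" for b
    using M0 that unfolding B(4) by blast
  have sumh: "sum h M = (\<Sum>b\<in>B. sum (Poly_Mapping.lookup b) M)" for M
    unfolding h_def by (rule sum.swap)
  have M0h: "M0 \<in> max_matchings E h"
  proof (rule max_matchingsI[OF max_matchingsD(1)[OF M0]])
    fix M' assume "M' \<in> matchings E"
    then show "sum h M' \<le> sum h M0"
      unfolding sumh using max_matchingsD(2)[OF M0b] by (intro sum_mono)
  qed
  have "M \<in> max_matchings E w \<longleftrightarrow> M \<in> max_matchings E h" for M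
  proof
    assume M: "M \<in> max_matchings E w"
    have "sum (Poly_Mapping.lookup b) M = sum (Poly_Mapping.lookup b) M0" if "b \<in> B" for b
      using M that M0b[OF that] unfolding B(4) by (intro max_matchings_value) auto
    then have "sum h M = sum h M0" unfolding sumh by simp
    then show "M \<in> max_matchings E h" using max_matchingsD(1)[OF M] unfolding max_matchings_iff[OF M0h] by simp
  next
    assume M: "M \<in> max_matchings E h"
    have MM: "M \<in> matchings E" using M by (rule max_matchingsD(1))
    have "sum (Poly_Mapping.lookup b) M = sum (Poly_Mapping.lookup b) M0" if "b \<in> B" for b
    proof (rule ccontr)
      assume ne: "sum (Poly_Mapping.lookup b) M \<noteq> sum (Poly_Mapping.lookup b) M0"
      have le: "sum (Poly_Mapping.lookup b) M \<le> sum (Poly_Mapping.lookup b) M0" if "b \<in> B" for b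
        by (rule max_matchingsD(2)[OF M0b[OF that] MM])
      have "sum h M < sum h M0" unfolding sumh
        using finB le ne that by (intro sum_strict_mono_ex1) (auto simp: less_le)
      then show False using max_matchings_value[OF M M0h] by simp
    qed
    then have "M \<in> max_matchings E (Poly_Mapping.lookup b)" if "b \<in> B" for b
      using MM that unfolding max_matchings_iff[OF M0b[OF that]] by simp
    then show "M \<in> max_matchings E w" using MM unfolding B(4) by simp
  qed
  then have "max_matchings E w = max_matchings E (\<lambda>e. real_of_int \<lfloor>h e\<rfloor>)"
    unfolding hfl by (rule set_eqI)
  from that[OF hb this] show thesis .
qed

section \<open>From perfect matchings of minimal weight to integral weights\<close>

lemma perfect_matching_card:
  assumes "simple_graph n E" "P \<in> perfect_matchings n E"
  shows "2 * card P = n" "P \<in> matchings E" "finite P"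
proof -
  have PE: "P \<subseteq> E" and part: "partition_on {1..n} P" using assms by (auto simp: perfect_matchings_def)
  have EC: "E \<subseteq> complete_edges n" using assms by (simp add: simple_graph_def)
  show fin: "finite P" using PE EC finite_complete_edges[of n] by (meson finite_subset)
  have dis: "disjoint P" using part by (simp add: partition_on_def)
  have "card (\<Union>P) = 2 * card P"
  proof (rule card_Union_pairs[OF fin dis])
    show "card e = 2" if "e \<in> P" for e
      using that PE EC by (auto simp: complete_edges_def)
  qed
  then show "2 * card P = n" using part by (simp add: partition_on_def)
  show "P \<in> matchings E" using PE dis by (simp add: matchings_def)
qed

text \<open>Passing to \<open>W = L - w\<close> turns minimal perfect matchings into maximal
  matchings without any perfectness constraint: one edge less costs \<open>L\<close>, which exceeds
  twice the sum of all \<open>\<bar>w e\<bar>\<close>, and no choice of edges can recover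
  that.\<close>

lemma face_integral_weight:
  fixes w :: "nat set \<Rightarrow> real"
  assumes G: "simple_graph n E" and P0: "P0 \<in> perfect_matchings n E" "sum w P0 = c"
    and valid: "\<And>P. P \<in> perfect_matchings n E \<Longrightarrow> c \<le> sum w P"
  obtains b :: "nat set \<Rightarrow> int"
  where "\<And>e. \<bar>b e\<bar> \<le> int (card E)"
    "\<And>P. P \<in> perfect_matchings n E \<Longrightarrow> (sum w P = c) = (sum b P = sum b P0)"
proof -
  have EC: "E \<subseteq> complete_edges n" using G by (simp add: simple_graph_def)
  have fin: "finite E" using EC finite_complete_edges[of n] by (rule finite_subset)
  have pairs: "\<forall>e\<in>E. card e = 2" using EC by (auto simp: complete_edges_def)
  define L where "L = 2 * (\<Sum>e\<in>E. \<bar>w e\<bar>) + 1"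
  define W where "W e = L - w e" for e
  have bound: "\<bar>sum w M\<bar> \<le> (\<Sum>e\<in>E. \<bar>w e\<bar>)" if "M \<in> matchings E" for M
  proof -
    have "\<bar>sum w M\<bar> \<le> (\<Sum>e\<in>M. \<bar>w e\<bar>)" by (rule sum_abs)
    also have "\<dots> \<le> (\<Sum>e\<in>E. \<bar>w e\<bar>)"
      using that fin by (intro sum_mono2) (auto simp: matchings_def)
    finally show ?thesis .
  qed
  have sumW: "sum W M = L * card M - sum w M" for M
    by (simp add: W_def sum_subtractf)
  \<comment> \<open>The existence of \<open>P0\<close> makes \<open>n\<close> even, so a matching
    that is not perfect misses at least two vertices.\<close>
  have perfect: "M \<in> perfect_matchings n E \<or> 2 * card M + 2 \<le> n" if M: "M \<in> matchings E" for M
  proof -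
    have finM: "finite M" "M \<subseteq> E" and dis: "disjoint M"
      using M fin finite_subset by (auto simp: matchings_def)
    have cU: "card (\<Union>M) = 2 * card M"
      using finM dis pairs by (intro card_Union_pairs) auto
    have sub: "\<Union>M \<subseteq> {1..n}" using finM EC by (auto simp: complete_edges_def)
    then have "card (\<Union>M) \<le> card {1..n}" by (intro card_mono) auto
    then have "2 * card M = n \<or> 2 * card M + 2 \<le> n"
      using perfect_matching_card(1)[OF G P0(1)] cU by simp presburger
    moreover have "M \<in> perfect_matchings n E" if "card (\<Union>M) = n"
    proof -
      have "\<Union>M = {1..n}" using sub that by (intro card_subset_eq) auto
      moreover have "{} \<notin> M" using finM pairs by fastforce
      ultimately show ?thesis using dis finM by (simp add: perfect_matchings_def partition_on_def)
    qed
    ultimately show ?thesis using cU by auto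
  qed
  have P0_max: "P0 \<in> max_matchings E W"
  proof (rule max_matchingsI)
    show "P0 \<in> matchings E" by (rule perfect_matching_card[OF G P0(1)])
    fix M assume M: "M \<in> matchings E"
    from perfect[OF M] show "sum W M \<le> sum W P0"
    proof
      assume P: "M \<in> perfect_matchings n E"
      have "card M = card P0"
        using perfect_matching_card(1)[OF G P] perfect_matching_card(1)[OF G P0(1)] by simp
      then show ?thesis using valid[OF P] P0(2) by (simp add: sumW)
    next
      assume "2 * card M + 2 \<le> n"
      then have "card M + 1 \<le> card P0" using perfect_matching_card(1)[OF G P0(1)] by simp
      then have "real (card M) + 1 \<le> real (card P0)" by linarith
      moreover have "L \<ge> 0" by (simp add: L_def sum_nonneg)
      ultimately have "L * (real (card M) + 1) \<le> L * real (card P0)" by (rule mult_left_mono)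
      then show ?thesis
        using bound[OF M] bound[OF perfect_matching_card(2)[OF G P0(1)]]
        by (simp add: sumW L_def distrib_left)
    qed
  qed
  obtain b :: "nat set \<Rightarrow> int" where b: "\<And>e. \<bar>b e\<bar> \<le> int (card E)"
    and bW: "max_matchings E W = max_matchings E (\<lambda>e. b e)"
    using max_matchings_integral_weight[OF fin pairs, of W] by blast
  have P0_b: "P0 \<in> max_matchings E (\<lambda>e. b e)" using P0_max bW by simp
  show thesis
  proof (rule that[OF b])
    fix P assume P: "P \<in> perfect_matchings n E"
    have "card P = card P0"
      using perfect_matching_card(1)[OF G P] perfect_matching_card(1)[OF G P0(1)] by simp
    then have "sum w P = c \<longleftrightarrow> P \<in> max_matchings E W"
      unfolding max_matchings_iff[OF P0_max] using perfect_matching_card(2)[OF G P] P0(2)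
      by (auto simp: sumW)
    also have "\<dots> \<longleftrightarrow> sum b P = sum b P0"
      unfolding bW max_matchings_iff[OF P0_b] using perfect_matching_card(2)[OF G P]
      by (simp flip: of_int_sum)
    finally show "(sum w P = c) = (sum b P = sum b P0)" .
  qed
qed

section \<open>Pfaffians by expansion along the first row\<close>

definition del :: "nat \<Rightarrow> 'b list \<Rightarrow> 'b list" where
  "del k xs = take k xs @ drop (Suc k) xs"

lemma del_simps [simp]:
  "del 0 (x # xs) = xs" "del (Suc k) (x # xs) = x # del k xs" "del k [] = []"
  by (simp_all add: del_def)

lemma length_del: "k < length xs \<Longrightarrow> length (del k xs) = length xs - 1"
  by (simp add: del_def)

lemma del_append:
  "del k (us @ vs) = (if k < length us then del k us @ vs else us @ del (k - length us) vs)"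
  by (simp add: del_def Suc_diff_le)

lemma nth_del: "k < length xs \<Longrightarrow> l < length xs - 1 \<Longrightarrow> del k xs ! l = (if l < k then xs ! l else xs ! Suc l)"
  by (auto simp: del_def nth_append)

lemma del_del: "p < q \<Longrightarrow> q < length xs \<Longrightarrow> del p (del q xs) = del (q - 1) (del p xs)"
proof (induction xs arbitrary: p q)
  case (Cons x xs)
  obtain q' where q: "q = Suc q'" using Cons.prems by (cases q) auto
  show ?case
  proof (cases p)
    case (Suc p')
    obtain q'' where "q' = Suc q''" using Cons.prems Suc q by (cases q') auto
    then show ?thesis using Cons.IH[of p' q'] Cons.prems Suc q by simp
  qed (simp add: q)
qed simp

text \<open>Indexing by lists allows repeated and unsorted rows, which the alternation laws are
  about. A singleton yields an empty sum, so every list of odd length has Pfaffian 0.\<close>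

function pf_list :: "('b \<Rightarrow> 'b \<Rightarrow> 'r::comm_ring_1) \<Rightarrow> 'b list \<Rightarrow> 'r" where
  "pf_list a [] = 1"
| "pf_list a (x # xs) = (\<Sum>k<length xs. (- 1) ^ k * a x (xs ! k) * pf_list a (del k xs))"
  by pat_completeness auto
termination by (relation "Wellfounded.measure (\<lambda>(a, xs). length xs)") (auto simp: length_del)

declare pf_list.simps(2) [simp del]

lemma pf_list_two:
  "pf_list a (x # y # zs) = a x y * pf_list a zs
     - (\<Sum>k<length zs. (- 1) ^ k * a x (zs ! k) * pf_list a (y # del k zs))"
  by (simp add: pf_list.simps(2)[of a x] sum.lessThan_Suc_shift sum_negf del: sum.lessThan_Suc)

lemma sum_triangle_swap:
  fixes f :: "nat \<Rightarrow> nat \<Rightarrow> 'c::comm_monoid_add"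
  shows "(\<Sum>k<N. \<Sum>m\<in>{Suc k..<N}. f k m) = (\<Sum>m<N. \<Sum>k<m. f k m)"
  unfolding sum.Sigma[OF finite_lessThan ballI[OF finite_atLeastLessThan]]
    sum.Sigma[OF finite_lessThan ballI[OF finite_lessThan]]
  by (rule sum.reindex_bij_witness[of _ "\<lambda>(m, k). (k, m)" "\<lambda>(k, m). (m, k)"]) auto

definition pf_minor2 :: "('b \<Rightarrow> 'b \<Rightarrow> 'r::comm_ring_1) \<Rightarrow> 'b list \<Rightarrow> nat \<Rightarrow> nat \<Rightarrow> 'r" where
  "pf_minor2 a zs p q = (- 1) ^ (p + q) * pf_list a (del p (del q zs))"

text \<open>The bracket is, up to sign, a 2 by 2 minor of the rows \<open>x\<close> and
  \<open>y\<close>. It changes sign when they are exchanged and vanishes when they coincide: the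
  base cases of both alternation lemmas.\<close>

lemma pf_list_two_rows:
  "pf_list a (x # y # zs) = a x y * pf_list a zs
     - (\<Sum>q<length zs. \<Sum>p<q. pf_minor2 a zs p q *
          (a x (zs ! q) * a y (zs ! p) - a x (zs ! p) * a y (zs ! q)))"
proof -
  define N where "N = length zs"
  define G where "G = pf_minor2 a zs"
  have inner: "(- 1) ^ k * a x (zs ! k) * pf_list a (y # del k zs)
      = (\<Sum>l<k. G l k * (a x (zs ! k) * a y (zs ! l)))
        - (\<Sum>m\<in>{Suc k..<N}. G k m * (a x (zs ! k) * a y (zs ! m)))" if k: "k < N" for k
  proof -
    have len: "length (del k zs) = N - 1" using k by (simp add: length_del N_def)
    have "(- 1) ^ k * a x (zs ! k) * pf_list a (y # del k zs)
      = (\<Sum>l<N-1. (- 1) ^ (k + l) * a x (zs ! k) * a y (del k zs ! l) * pf_list a (del l (del k zs)))"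
      by (simp add: pf_list.simps(2) len sum_distrib_left power_add mult_ac)
    also have "{..<N-1} = {..<k} \<union> {k..<N-1}" using k by auto
    also have "(\<Sum>l\<in>{..<k} \<union> {k..<N-1}. (- 1) ^ (k + l) * a x (zs ! k) * a y (del k zs ! l) * pf_list a (del l (del k zs)))
      = (\<Sum>l<k. (- 1) ^ (k + l) * a x (zs ! k) * a y (del k zs ! l) * pf_list a (del l (del k zs)))
      + (\<Sum>l\<in>{k..<N-1}. (- 1) ^ (k + l) * a x (zs ! k) * a y (del k zs ! l) * pf_list a (del l (del k zs)))"
      by (rule sum.union_disjoint) auto
    also have "(\<Sum>l<k. (- 1) ^ (k + l) * a x (zs ! k) * a y (del k zs ! l) * pf_list a (del l (del k zs)))
      = (\<Sum>l<k. G l k * (a x (zs ! k) * a y (zs ! l)))"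
      using k by (intro sum.cong refl) (simp add: G_def pf_minor2_def nth_del N_def add_ac mult_ac)
    \<comment> \<open>Behind the deleted position \<open>k\<close>, index \<open>l\<close> denotes
      the original position \<open>Suc l\<close>; this shift by one is the source of the minus
      sign.\<close>
    also have "(\<Sum>l\<in>{k..<N-1}. (- 1) ^ (k + l) * a x (zs ! k) * a y (del k zs ! l) * pf_list a (del l (del k zs)))
      = (\<Sum>l\<in>{k..<N-1}. - (G k (Suc l) * (a x (zs ! k) * a y (zs ! Suc l))))"
    proof (intro sum.cong refl)
      fix l assume l: "l \<in> {k..<N-1}"
      then have "del l (del k zs) = del k (del (Suc l) zs)"
        using k del_del[of k "Suc l" zs] by (auto simp: N_def)
      then show "(- 1) ^ (k + l) * a x (zs ! k) * a y (del k zs ! l) * pf_list a (del l (del k zs))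
          = - (G k (Suc l) * (a x (zs ! k) * a y (zs ! Suc l)))"
        using k l by (simp add: G_def pf_minor2_def nth_del N_def mult_ac)
    qed
    also have "\<dots> = (\<Sum>m\<in>{Suc k..<N}. - (G k m * (a x (zs ! k) * a y (zs ! m))))"
      using k by (intro sum.reindex_bij_witness[of _ "\<lambda>m. m - 1" Suc]) auto
    finally show ?thesis by (simp add: sum_negf)
  qed
  have "(\<Sum>k<N. (- 1) ^ k * a x (zs ! k) * pf_list a (y # del k zs))
    = (\<Sum>k<N. (\<Sum>l<k. G l k * (a x (zs ! k) * a y (zs ! l)))
        - (\<Sum>m\<in>{Suc k..<N}. G k m * (a x (zs ! k) * a y (zs ! m))))"
    by (intro sum.cong refl inner) auto
  also have "\<dots> = (\<Sum>q<N. \<Sum>p<q. G p q * (a x (zs ! q) * a y (zs ! p) - a x (zs ! p) * a y (zs ! q)))"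
    by (simp add: sum_subtractf sum_triangle_swap right_diff_distrib)
  finally show ?thesis by (simp add: pf_list_two N_def G_def)
qed

section \<open>Alternation and row operations\<close>

context
  fixes a :: "'b \<Rightarrow> 'b \<Rightarrow> 'r::comm_ring_1"
  assumes skew: "\<And>x y. a x y = - a y x" and diag: "\<And>x. a x x = 0"
begin

lemma pf_list_swap: "pf_list a (us @ x # y # zs) = - pf_list a (us @ y # x # zs)"
proof (induction "length us" arbitrary: us zs rule: less_induct)
  case less
  show ?case
  proof (cases us)
    case Nil
    let ?D = "\<lambda>x y. \<Sum>q<length zs. \<Sum>p<q. pf_minor2 a zs p q *
      (a x (zs ! q) * a y (zs ! p) - a x (zs ! p) * a y (zs ! q))"
    have "?D y x = - ?D x y"
      unfolding sum_negf[symmetric] by (intro sum.cong refl) (simp add: algebra_simps)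
    then show ?thesis using Nil by (simp add: pf_list_two_rows skew[of y x])
  next
    case (Cons u us')
    define m where "m = length us'"
    define W where "W = us' @ x # y # zs"
    define W' where "W' = us' @ y # x # zs"
    have len: "length W = m + 2 + length zs" "length W' = m + 2 + length zs"
      by (simp_all add: W_def W'_def m_def)
    define f where "f V k = (- 1) ^ k * a u (V ! k) * pf_list a (del k V)" for V k
    have IH: "pf_list a (vs @ x # y # vs') = - pf_list a (vs @ y # x # vs')" if "length vs \<le> m" for vs vs'
      using less[of vs vs'] that by (simp add: Cons m_def)
    \<comment> \<open>If neither \<open>x\<close> nor \<open>y\<close> is deleted, the induction
      hypothesis supplies the sign. If one of them is, the same list remains on both sides and the
      sign comes from the neighbouring position.\<close>
    have eq: "f W k = - f W' (Transposition.transpose m (Suc m) k)" for k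
    proof -
      consider "k < m" | "k = m" | "k = Suc m" | "k \<ge> m + 2" by linarith
      then show ?thesis
      proof cases
        case 1
        then have "pf_list a (del k us' @ x # y # zs) = - pf_list a (del k us' @ y # x # zs)"
          by (intro IH) (simp add: length_del m_def)
        then show ?thesis using 1
          by (simp add: f_def W_def W'_def m_def del_append nth_append Transposition.transpose_def)
      next
        case 4
        then obtain j where "k = m + 2 + j" using le_Suc_ex by blast
        then show ?thesis using IH[of us' "del j zs"]
          by (simp add: f_def W_def W'_def m_def del_append nth_append Transposition.transpose_def)
      qed (simp_all add: f_def W_def W'_def m_def del_append nth_append Suc_diff_le)
    qed
    have "(\<Sum>k<length W. f W k) = (\<Sum>k<length W. - f W' (Transposition.transpose m (Suc m) k))"
      by (simp add: eq)
    also have "\<dots> = (\<Sum>k<length W'. - f W' k)"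
      by (rule sum.reindex_bij_witness[of _ "Transposition.transpose m (Suc m)" "Transposition.transpose m (Suc m)"])
        (auto simp: len Transposition.transpose_def)
    finally show ?thesis
      by (simp add: Cons pf_list.simps(2) sum_negf f_def W_def W'_def)
  qed
qed

text \<open>Exchanging equal neighbours only shows that the Pfaffian is its own negative, which says
  nothing in characteristic 2. The zero diagonal and a separate induction take its place.\<close>

lemma pf_list_repeated_adjacent: "pf_list a (us @ x # x # zs) = 0"
proof (induction "length us" arbitrary: us zs rule: less_induct)
  case less
  show ?case
  proof (cases us)
    case Nil
    then show ?thesis by (simp add: pf_list_two_rows diag mult.commute)
  next
    case (Cons u us')
    define m where "m = length us'"
    define W where "W = us' @ x # x # zs"
    define f where "f k = (- 1) ^ k * a u (W ! k) * pf_list a (del k W)" for k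
    have IH: "pf_list a (vs @ x # x # vs') = 0" if "length vs \<le> m" for vs vs'
      using less[of vs vs'] that by (simp add: Cons m_def)
    have 0: "f k = 0" if "k \<noteq> m" "k \<noteq> Suc m" for k
    proof (cases "k < m")
      case True
      then have "pf_list a (del k us' @ x # x # zs) = 0"
        by (intro IH) (simp add: length_del m_def)
      then show ?thesis using True by (simp add: f_def W_def m_def del_append)
    next
      case False
      then have "m + 2 \<le> k" using that by simp
      then obtain j where "k = m + 2 + j" using le_Suc_ex by blast
      then show ?thesis using IH[of us' "del j zs"]
        by (simp add: f_def W_def m_def del_append)
    qed
    have "(\<Sum>k<length W. f k) = (\<Sum>k\<in>{m, Suc m}. f k)"
      using 0 by (intro sum.mono_neutral_right) (auto simp: W_def m_def)
    also have "\<dots> = 0"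
      by (simp add: f_def W_def m_def del_append nth_append Suc_diff_le)
    finally show ?thesis by (simp add: Cons pf_list.simps(2) f_def W_def)
  qed
qed

lemma pf_list_repeated: "x \<in> set ys \<Longrightarrow> pf_list a (x # ys) = 0"
proof -
  have *: "pf_list a (x # us @ x # vs) = 0" for us vs
  proof (induction us arbitrary: vs rule: rev_induct)
    case Nil
    then show ?case using pf_list_repeated_adjacent[of "[]"] by simp
  next
    case (snoc u us)
    then show ?case using pf_list_swap[of "x # us" u x vs] by simp
  qed
  assume "x \<in> set ys"
  then obtain us vs where "ys = us @ x # vs" by (meson split_list)
  then show ?thesis by (simp add: *)
qed

text \<open>Adding the combination \<open>z\<close> of the rows \<open>xs\<close> to the row of \<open>x\<close> clears it except at \<open>y\<close>.\<close>

lemma pf_list_schur: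
  assumes "finite X" "X \<subseteq> set xs"
    and z: "\<And>j. j \<in> set xs \<Longrightarrow> (\<Sum>i\<in>X. z i * a i j) = - a x j"
  shows "pf_list a (x # y # xs) = (a x y + (\<Sum>i\<in>X. z i * a i y)) * pf_list a xs"
proof -
  let ?W = "y # xs"
  define r where "r v = a x v + (\<Sum>i\<in>X. z i * a i v)" for v
  have "(\<Sum>k<length ?W. (- 1) ^ k * r (?W ! k) * pf_list a (del k ?W))
      = (\<Sum>k\<in>{0}. (- 1) ^ k * r (?W ! k) * pf_list a (del k ?W))"
  proof (rule sum.mono_neutral_right)
    show "\<forall>k\<in>{..<length ?W} - {0}. (- 1) ^ k * r (?W ! k) * pf_list a (del k ?W) = 0"
    proof
      fix k assume k: "k \<in> {..<length ?W} - {0}"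
      then have "?W ! k \<in> set xs" by (auto simp: nth_Cons')
      then have "r (?W ! k) = 0" using z by (simp add: r_def)
      then show "(- 1) ^ k * r (?W ! k) * pf_list a (del k ?W) = 0" by simp
    qed
  qed auto
  then have 1: "(\<Sum>k<length ?W. (- 1) ^ k * r (?W ! k) * pf_list a (del k ?W)) = r y * pf_list a xs"
    by simp
  have "(\<Sum>k<length ?W. (- 1) ^ k * r (?W ! k) * pf_list a (del k ?W))
     = pf_list a (x # ?W) + (\<Sum>k<length ?W. \<Sum>i\<in>X. z i * ((- 1) ^ k * a i (?W ! k) * pf_list a (del k ?W)))"
    unfolding pf_list.simps(2)[of a x ?W] sum.distrib[symmetric]
    by (intro sum.cong refl) (simp add: r_def algebra_simps sum_distrib_left)
  \<comment> \<open>The added rows contribute expansions of Pfaffians whose first entry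
    \<open>i\<close> occurs again in \<open>xs\<close>, so all of them vanish.\<close>
  also have "(\<Sum>k<length ?W. \<Sum>i\<in>X. z i * ((- 1) ^ k * a i (?W ! k) * pf_list a (del k ?W)))
     = (\<Sum>i\<in>X. z i * pf_list a (i # ?W))"
    unfolding pf_list.simps(2) sum_distrib_left by (rule sum.swap)
  also have "\<dots> = 0"
  proof (rule sum.neutral, rule ballI)
    fix i assume "i \<in> X"
    then have "i \<in> set ?W" using assms(2) by auto
    then show "z i * pf_list a (i # ?W) = 0" by (simp only: pf_list_repeated mult_zero_right)
  qed
  finally show ?thesis using 1 by (simp add: r_def)
qed

end

section \<open>Pfaffians as sums over perfect matchings\<close>

fun inversion_count :: "nat list \<Rightarrow> nat" where
  "inversion_count [] = 0"
| "inversion_count (x # xs) = length (filter (\<lambda>y. y < x) xs) + inversion_count xs"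

lemma inversion_count_swap:
  "y < x \<Longrightarrow> inversion_count (us @ x # y # vs) = Suc (inversion_count (us @ y # x # vs))"
  by (induction us) auto

lemma inversion_count_sorted: "sorted ws \<Longrightarrow> inversion_count ws = 0"
proof (induction ws)
  case (Cons x ws)
  then have "filter (\<lambda>y. y < x) ws = []" by (auto simp: filter_empty_conv)
  then show ?case using Cons by simp
qed simp

text \<open>Generalizes \<open>matching_perm\<close> to arbitrary words, since sorting by adjacent
  exchanges leaves the words that come from matchings.\<close>

definition word_perm :: "nat list \<Rightarrow> nat \<Rightarrow> nat" where
  "word_perm ws i = (if i \<in> {1..length ws} then ws ! (i - 1) else i)"

lemma word_perm_permutes:
  assumes "distinct ws" "set ws = {1..length ws}"
  shows "word_perm ws permutes {1..length ws}"
proof -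
  let ?n = "length ws"
  have "bij_betw (\<lambda>i. i - 1) {1..?n} {..<?n}" by (rule bij_betwI[of _ _ _ Suc]) auto
  moreover have "bij_betw (nth ws) {..<?n} {1..?n}" using bij_betw_nth[OF assms(1)] assms(2) by simp
  ultimately have "bij_betw (nth ws \<circ> (\<lambda>i. i - 1)) {1..?n} {1..?n}" by (rule bij_betw_trans)
  then have "bij_betw (word_perm ws) {1..?n} {1..?n}"
    by (rule bij_betw_cong[THEN iffD1, rotated]) (simp add: word_perm_def)
  then show ?thesis by (rule bij_imp_permutes) (auto simp: word_perm_def)
qed

lemma sign_word_perm:
  assumes "distinct ws" "set ws = {1..length ws}"
  shows "sign (word_perm ws) = (- 1) ^ inversion_count ws"
  using assms
proof (induction "inversion_count ws" arbitrary: ws rule: less_induct)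
  case less
  show ?case
  proof (cases "sorted ws")
    case True
    let ?n = "length ws"
    have ws: "ws = [1..<Suc ?n]"
    proof (rule sorted_distinct_set_unique[OF True less.prems(1)])
      show "set ws = set [1..<Suc ?n]"
        using less.prems(2) by (simp only: set_upt atLeastLessThanSuc_atLeastAtMost)
    qed (simp_all del: upt_Suc)
    have "ws ! k = Suc k" if "k < ?n" for k
      using that nth_upt[of 1 k "Suc ?n"] arg_cong[OF ws, of "\<lambda>l. l ! k"] by (simp del: upt_Suc)
    then have "word_perm ws = id" by (auto simp: word_perm_def fun_eq_iff)
    then show ?thesis using inversion_count_sorted[OF True] by simp
  next
    case False
    \<comment> \<open>Exchanging an adjacent descent removes one inversion and composes the
      permutation with a transposition of positions. Positions count from 1, hence
      \<open>Suc i\<close> and \<open>Suc (Suc i)\<close>.\<close>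
    then obtain i where i: "Suc i < length ws" "ws ! Suc i < ws ! i"
      by (auto simp: sorted_iff_nth_Suc not_le)
    define us where "us = take i ws"
    define vs where "vs = drop (Suc (Suc i)) ws"
    define x where "x = ws ! i"
    define y where "y = ws ! Suc i"
    have ws: "ws = us @ x # y # vs"
      using i by (simp add: us_def vs_def x_def y_def Cons_nth_drop_Suc)
    define ws' where "ws' = us @ y # x # vs"
    have inv: "inversion_count ws = Suc (inversion_count ws')"
      unfolding ws ws'_def using i by (intro inversion_count_swap) (simp add: x_def y_def)
    have ws': "distinct ws'" "set ws' = {1..length ws'}" "length ws' = length ws"
      using less.prems by (auto simp: ws ws'_def)
    have IH: "sign (word_perm ws') = (- 1) ^ inversion_count ws'"
      using less.hyps[of ws'] inv ws' by simp
    have li: "length us = i" using i by (simp add: us_def)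
    have "word_perm ws = word_perm ws' \<circ> Transposition.transpose (Suc i) (Suc (Suc i))"
    proof
      fix k
      consider "k = Suc i" | "k = Suc (Suc i)" | "k \<noteq> Suc i" "k \<noteq> Suc (Suc i)" by blast
      then show "word_perm ws k = (word_perm ws' \<circ> Transposition.transpose (Suc i) (Suc (Suc i))) k"
      proof cases
        case 3
        then show ?thesis
          by (auto simp: word_perm_def ws ws'_def li nth_append nth_Cons' transpose_apply_other)
      qed (use i in \<open>simp_all add: word_perm_def ws ws'_def li nth_append\<close>)
    qed
    moreover have "permutation (word_perm ws')"
      using word_perm_permutes[OF ws'(1,2)] by (meson finite_atLeastAtMost permutation_permutes)
    ultimately have "sign (word_perm ws) = - sign (word_perm ws')"
      by (simp add: sign_compose permutation_swap_id sign_swap_id)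
    then show ?thesis by (simp add: IH inv)
  qed
qed

section \<open>Recursive enumeration of perfect matchings and their words\<close>

definition pairings :: "nat set \<Rightarrow> nat set set set" where
  "pairings S = {P. partition_on S P \<and> (\<forall>e\<in>P. card e = 2)}"

lemma perfect_matchings_complete: "perfect_matchings n (complete_edges n) = pairings {1..n}"
  by (auto simp: perfect_matchings_def pairings_def complete_edges_def partition_on_def)

lemma pairing_block:
  assumes "P \<in> pairings S" "e \<in> P"
  shows "finite e" "Min e < Max e" "e = {Min e, Max e}" "e \<subseteq> S"
proof -
  obtain a b where e: "e = {a, b}" "a \<noteq> b" using assms by (auto simp: pairings_def card_2_iff)
  show "finite e" using e by simp
  show "Min e < Max e" using e by (auto simp: min_def max_def)
  show "e = {Min e, Max e}" using e by (auto simp: min_def max_def)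
  show "e \<subseteq> S" using assms by (auto simp: pairings_def partition_on_def)
qed

lemma pairing_unique:
  assumes "P \<in> pairings S" "e \<in> P" "e' \<in> P" "x \<in> e" "x \<in> e'"
  shows "e = e'"
proof (rule ccontr)
  assume "e \<noteq> e'"
  moreover have "disjoint P" using assms(1) by (simp add: pairings_def partition_on_def)
  ultimately have "e \<inter> e' = {}" using assms(2,3) by (intro disjointD)
  then show False using assms(4,5) by blast
qed

lemma pairings_Union: "P \<in> pairings S \<Longrightarrow> \<Union>P = S"
  by (simp add: pairings_def partition_on_def)

lemma finite_pairing: "P \<in> pairings S \<Longrightarrow> finite S \<Longrightarrow> finite P"
  by (metis finite_UnionD pairings_Union)

lemma finite_pairings: "finite S \<Longrightarrow> finite (pairings S)"
  by (rule finite_subset[of _ "Pow (Pow S)"]) (use pairings_Union in auto)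

lemma pairings_empty: "pairings {} = {{}}"
  by (auto simp: pairings_def partition_on_def)

lemma pairings_insert_pair:
  assumes "x \<notin> S" "y \<in> S" "P \<in> pairings (S - {y})"
  shows "insert {x, y} P \<in> pairings (insert x S)" "{x, y} \<notin> P"
proof -
  have U: "\<Union>P = S - {y}" using assms(3) by (rule pairings_Union)
  then show "{x, y} \<notin> P" by blast
  have "partition_on (insert x S) (insert {x, y} P)"
    using assms U unfolding pairings_def partition_on_def
    by (auto simp: pairwise_insert disjnt_def)
  moreover have "x \<noteq> y" using assms by auto
  ultimately show "insert {x, y} P \<in> pairings (insert x S)"
    using assms by (auto simp: pairings_def)
qed

text \<open>Classification by the partner \<open>y\<close> of \<open>x\<close>. What remains is a
  set with a gap at \<open>y\<close>, which is why pairings are taken over arbitrary sets and not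
  only over \<open>{1..n}\<close>.\<close>

lemma pairings_insert:
  assumes "x \<notin> S"
  shows "pairings (insert x S) = (\<Union>y\<in>S. insert {x, y} ` pairings (S - {y}))"
proof (rule equalityI; rule subsetI)
  fix P assume P: "P \<in> pairings (insert x S)"
  then obtain e where e: "e \<in> P" "x \<in> e" using pairings_Union[OF P] by blast
  have "card e = 2" using P e by (simp add: pairings_def)
  then obtain y where y: "e = {x, y}" "y \<noteq> x" using e by (auto simp: card_2_iff)
  have yS: "y \<in> S" using y e pairings_Union[OF P] by blast
  have "P - {e} \<in> pairings (S - {y})"
  proof -
    have "\<Union>(P - {e}) = S - {y}"
    proof (rule equalityI; rule subsetI)
      fix v assume "v \<in> \<Union>(P - {e})"
      then obtain f where f: "f \<in> P" "f \<noteq> e" "v \<in> f" by blast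
      then have "v \<notin> e" using pairing_unique[OF P f(1) e(1) f(3)] by blast
      moreover have "v \<in> insert x S" using f pairings_Union[OF P] by blast
      ultimately show "v \<in> S - {y}" using y by blast
    next
      fix v assume v: "v \<in> S - {y}"
      then obtain f where "f \<in> P" "v \<in> f" using pairings_Union[OF P] by blast
      moreover have "v \<notin> e" using v y assms by blast
      ultimately show "v \<in> \<Union>(P - {e})" by blast
    qed
    then show ?thesis using P
      by (auto simp: pairings_def partition_on_def intro: pairwise_subset)
  qed
  moreover have "P = insert {x, y} (P - {e})" using e y by auto
  ultimately show "P \<in> (\<Union>y\<in>S. insert {x, y} ` pairings (S - {y}))" using yS by blast
next
  fix P assume "P \<in> (\<Union>y\<in>S. insert {x, y} ` pairings (S - {y}))"
  then show "P \<in> pairings (insert x S)" using pairings_insert_pair[OF assms] by blast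
qed

lemma sum_pairings_insert:
  fixes F :: "nat set set \<Rightarrow> 'c::comm_monoid_add"
  assumes "finite S" "x \<notin> S"
  shows "(\<Sum>P\<in>pairings (insert x S). F P) = (\<Sum>y\<in>S. \<Sum>P\<in>pairings (S - {y}). F (insert {x, y} P))"
proof -
  have "(\<Sum>P\<in>pairings (insert x S). F P) = (\<Sum>y\<in>S. \<Sum>P\<in>insert {x, y} ` pairings (S - {y}). F P)"
    unfolding pairings_insert[OF assms(2)]
  proof (rule sum.UNION_disjoint)
    show "\<forall>y\<in>S. \<forall>y'\<in>S. y \<noteq> y' \<longrightarrow> insert {x, y} ` pairings (S - {y}) \<inter> insert {x, y'} ` pairings (S - {y'}) = {}"
    proof (intro ballI impI, rule ccontr)
      fix y y' assume y: "y \<in> S" "y' \<in> S" "y \<noteq> y'"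
        and "insert {x, y} ` pairings (S - {y}) \<inter> insert {x, y'} ` pairings (S - {y'}) \<noteq> {}"
      then obtain P P' where P: "P \<in> pairings (S - {y})" "P' \<in> pairings (S - {y'})"
        "insert {x, y} P = insert {x, y'} P'" by blast
      have "{x, y} = {x, y'}"
      proof (rule pairing_unique[OF pairings_insert_pair(1)[OF assms(2) y(1) P(1)]])
        show "{x, y'} \<in> insert {x, y} P" unfolding P(3) by simp
      qed auto
      then show False using y assms(2) by (auto simp: doubleton_eq_iff)
    qed
  qed (use assms finite_pairings in auto)
  also have "\<dots> = (\<Sum>y\<in>S. \<Sum>P\<in>pairings (S - {y}). F (insert {x, y} P))"
  proof (rule sum.cong[OF refl])
    fix y assume y: "y \<in> S"
    have "inj_on (insert {x, y}) (pairings (S - {y}))"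
      using pairings_insert_pair(2)[OF assms(2) y] by (intro inj_onI) (metis insert_ident)
    then show "(\<Sum>P\<in>insert {x, y} ` pairings (S - {y}). F P) = (\<Sum>P\<in>pairings (S - {y}). F (insert {x, y} P))"
      by (simp add: sum.reindex)
  qed
  finally show ?thesis .
qed

text \<open>The third part makes the enumeration computable: any list with strictly increasing
  minima and the right elements must be the sorted one.\<close>

lemma sorted_key_list_of_set_Min:
  fixes P :: "nat set set"
  assumes "inj_on Min P" "finite P"
  shows "sorted_wrt (<) (map Min (sorted_key_list_of_set Min P))"
    "set (sorted_key_list_of_set Min P) = P"
    "\<And>l. sorted_wrt (<) (map Min l) \<Longrightarrow> set l = P \<Longrightarrow> sorted_key_list_of_set Min P = l"
proof -
  interpret key: folding_insort_key "(\<le>)" "(<)" P "Min :: nat set \<Rightarrow> nat"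
    rewrites "linorder.sorted_key_list_of_set (\<le>) Min = sorted_key_list_of_set (Min :: nat set \<Rightarrow> nat)"
  proof -
    show "folding_insort_key (\<le>) (<) P (Min :: nat set \<Rightarrow> nat)" by unfold_locales (fact assms(1))
    show "linorder.sorted_key_list_of_set (\<le>) Min = sorted_key_list_of_set (Min :: nat set \<Rightarrow> nat)"
      unfolding sorted_key_list_of_set_def insort_key_def
        linorder.sorted_key_list_of_set_def[OF linorder_class.linorder_axioms]
        linorder.insort_key_def[OF linorder_class.linorder_axioms] ..
  qed
  show "sorted_wrt (<) (map Min (sorted_key_list_of_set Min P))"
    by (rule key.strict_sorted_key_list_of_set) simp
  show "set (sorted_key_list_of_set Min P) = P"
    using assms(2) by (rule key.set_sorted_key_list_of_set[OF order_refl])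
  fix l assume l: "sorted_wrt (<) (map Min l)" "set l = P"
  have "distinct l" using l(1) by (auto simp: strict_sorted_iff distinct_map)
  then show "sorted_key_list_of_set Min P = l"
    using key.sorted_key_list_of_set_unique[OF order_refl assms(2), of l] l distinct_card[of l]
    by simp
qed

lemma pairing_inj_Min: "P \<in> pairings S \<Longrightarrow> inj_on Min P"
proof (rule inj_onI)
  fix e e' assume P: "P \<in> pairings S" and *: "e \<in> P" "e' \<in> P" "Min e = Min e'"
  have "Min e \<in> e" "Min e \<in> e'"
    using pairing_block(3)[OF P *(1)] pairing_block(3)[OF P *(2)] *(3) by (metis insertI1)+
  then show "e = e'" using pairing_unique[OF P *(1,2)] by blast
qed

text \<open>As \<open>x\<close> lies below all of \<open>S\<close>, the new block has the least
  minimum and comes first in the word.\<close>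

lemma matching_word_insert:
  assumes P: "P \<in> pairings (S - {y})" and S: "finite S" "y \<in> S" and x: "\<And>v. v \<in> S \<Longrightarrow> x < v"
  shows "matching_word (insert {x, y} P) = x # y # matching_word P"
proof -
  have xy: "x < y" using x S by blast
  have "x \<notin> S" using x by blast
  note P' = pairings_insert_pair(1)[OF this S(2) P]
  have fin: "finite P" using P S by (auto intro: finite_pairing)
  note sorted = sorted_key_list_of_set_Min[OF pairing_inj_Min[OF P] fin]
  have min: "Min {x, y} = x" "Max {x, y} = y" using xy by auto
  have less: "x < Min e" if "e \<in> P" for e
  proof -
    have "Min e \<in> e" using pairing_block(3)[OF P that] by (metis insertI1)
    then show ?thesis using x pairing_block(4)[OF P that] by blast
  qed
  have "sorted_key_list_of_set Min (insert {x, y} P) = {x, y} # sorted_key_list_of_set Min P"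
  proof (rule sorted_key_list_of_set_Min(3)[OF pairing_inj_Min[OF P']])
    show "finite (insert {x, y} P)" using fin by simp
    show "sorted_wrt (<) (map Min ({x, y} # sorted_key_list_of_set Min P))"
      using sorted(1,2) less min by auto
    show "set ({x, y} # sorted_key_list_of_set Min P) = insert {x, y} P" using sorted(2) by simp
  qed
  then show ?thesis using min by (simp add: matching_word_def)
qed

lemma matching_word_set:
  assumes P: "P \<in> pairings S" and "finite S"
  shows "set (matching_word P) = S"
proof -
  have "set (matching_word P) = (\<Union>e\<in>P. {Min e, Max e})"
    unfolding matching_word_def
    using sorted_key_list_of_set_Min(2)[OF pairing_inj_Min[OF P] finite_pairing[OF assms]] by auto
  also have "\<dots> = (\<Union>e\<in>P. e)" using pairing_block(3)[OF P] by (intro SUP_cong) auto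
  finally show ?thesis using pairings_Union[OF P] by simp
qed

lemma matching_word_distinct:
  assumes P: "P \<in> pairings S" and "finite S"
  shows "distinct (matching_word P)"
  using assms
proof (induction "card S" arbitrary: S P rule: less_induct)
  case less
  show ?case
  proof (cases "S = {}")
    case True
    then show ?thesis using less.prems sorted_key_list_of_set_Min(2)[of "{}"] by (auto simp: pairings_empty matching_word_def)
  next
    case False
    define x where "x = Min S"
    define T where "T = S - {x}"
    have xS: "x \<in> S" using False less.prems by (simp add: x_def)
    have S: "S = insert x T" "x \<notin> T" "finite T" using xS less.prems by (auto simp: T_def)
    have lt: "x < v" if "v \<in> T" for v
      using that less.prems by (simp add: T_def x_def) (metis Min_le le_neq_implies_less)
    obtain y P' where y: "y \<in> T" "P = insert {x, y} P'" "P' \<in> pairings (T - {y})"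
      using less.prems(1) unfolding S(1) pairings_insert[OF S(2)] by (elim UN_E imageE)
    have "card (T - {y}) < card S" using S y by (intro psubset_card_mono) auto
    then have "distinct (matching_word P')" by (rule less.hyps[OF _ y(3)]) (use S(3) in simp)
    moreover have "set (matching_word P') = T - {y}" using matching_word_set[OF y(3)] S(3) by simp
    ultimately show ?thesis using y lt[OF y(1)] S matching_word_insert[OF y(3) S(3) y(1) lt] by auto
  qed
qed

lemma matching_sign_inversions:
  assumes "P \<in> pairings {1..n}"
  shows "matching_sign n P = (- 1) ^ inversion_count (matching_word P)"
proof -
  have set: "set (matching_word P) = {1..n}" and dist: "distinct (matching_word P)"
    using matching_word_set[OF assms] matching_word_distinct[OF assms] by simp_all
  then have len: "length (matching_word P) = n" using distinct_card[OF dist] by simp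
  have "matching_perm n P = word_perm (matching_word P)"
    by (simp add: fun_eq_iff matching_perm_def word_perm_def len)
  then show ?thesis using sign_word_perm[OF dist] set len by (simp add: matching_sign_def)
qed

lemma set_del: "distinct xs \<Longrightarrow> k < length xs \<Longrightarrow> set (del k xs) = set xs - {xs ! k}"
proof (induction xs arbitrary: k)
  case (Cons x xs)
  then show ?case by (cases k) auto
qed simp

lemma strict_sorted_del: "sorted_wrt (<) xs \<Longrightarrow> sorted_wrt (<) (del k xs)"
proof (induction xs arbitrary: k)
  case (Cons x xs)
  have "set (del j xs) \<subseteq> set xs" for j unfolding del_def by (auto dest: in_set_takeD in_set_dropD)
  then show ?case using Cons by (cases k) auto
qed simp

lemma card_less_nth:
  "sorted_wrt (<) xs \<Longrightarrow> k < length xs \<Longrightarrow> card {v \<in> set xs. v < xs ! k} = k" for xs :: "nat list"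
proof -
  assume xs: "sorted_wrt (<) xs" and k: "k < length xs"
  have "{v \<in> set xs. v < xs ! k} = set (take k xs)"
  proof (intro equalityI subsetI)
    fix v assume "v \<in> {v \<in> set xs. v < xs ! k}"
    then obtain j where j: "j < length xs" "v = xs ! j" "xs ! j < xs ! k" by (auto simp: in_set_conv_nth)
    have "j < k"
    proof (rule ccontr)
      assume "\<not> j < k"
      then have "xs ! k \<le> xs ! j" using xs j(1) by (metis linorder_neqE_nat order.strict_implies_order order_refl sorted_wrt_nth_less)
      then show False using j by simp
    qed
    then show "v \<in> set (take k xs)" using j k by (auto simp: in_set_conv_nth)
  next
    fix v assume "v \<in> set (take k xs)"
    then obtain j where "j < k" "v = xs ! j" using k by (auto simp: in_set_conv_nth)
    then show "v \<in> {v \<in> set xs. v < xs ! k}" using xs k sorted_wrt_nth_less by fastforce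
  qed
  moreover have "distinct (take k xs)" using xs by (simp add: strict_sorted_iff)
  ultimately show ?thesis using k by (simp add: distinct_card)
qed

text \<open>In a sorted list the leading \<open>x\<close> causes no inversion, and its partner
  \<open>ys ! k\<close> causes one with each of the \<open>k\<close> smaller entries of
  \<open>ys\<close>. This is exactly the sign \<open>(- 1) ^ k\<close> of the expansion.\<close>

lemma pf_list_pairings:
  fixes a :: "nat \<Rightarrow> nat \<Rightarrow> 'r::comm_ring_1"
  assumes "sorted_wrt (<) xs"
  shows "pf_list a xs = (\<Sum>P\<in>pairings (set xs).
    (- 1) ^ inversion_count (matching_word P) * (\<Prod>e\<in>P. a (Min e) (Max e)))"
  using assms
proof (induction "length xs" arbitrary: xs rule: less_induct)
  case less
  show ?case
  proof (cases xs)
    case Nil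
    have "matching_word {} = []" using sorted_key_list_of_set_Min(2)[of "{}"] by (simp add: matching_word_def)
    then show ?thesis using Nil by (simp add: pairings_empty)
  next
    case (Cons x ys)
    have sorted: "sorted_wrt (<) ys" and x: "\<And>v. v \<in> set ys \<Longrightarrow> x < v"
      using less.prems Cons by auto
    have dist: "distinct ys" using sorted by (simp add: strict_sorted_iff)
    have xn: "x \<notin> set ys" using x by blast
    let ?F = "\<lambda>P. (- 1) ^ inversion_count (matching_word P) * (\<Prod>e\<in>P. a (Min e) (Max e))"
    have "(\<Sum>P\<in>pairings (set xs). ?F P)
      = (\<Sum>y\<in>set ys. \<Sum>P\<in>pairings (set ys - {y}). ?F (insert {x, y} P))"
      unfolding Cons list.set by (rule sum_pairings_insert) (use xn in auto)
    also have "\<dots> = (\<Sum>k<length ys. \<Sum>P\<in>pairings (set ys - {ys ! k}). ?F (insert {x, ys ! k} P))"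
      by (rule sum.reindex_bij_betw[OF bij_betw_nth[OF dist refl refl], symmetric])
    also have "\<dots> = (\<Sum>k<length ys. (- 1) ^ k * a x (ys ! k) * pf_list a (del k ys))"
    proof (intro sum.cong refl)
      fix k assume "k \<in> {..<length ys}"
      then have k: "k < length ys" by simp
      have yk: "ys ! k \<in> set ys" using k by simp
      have "?F (insert {x, ys ! k} P) = (- 1) ^ k * a x (ys ! k) * ?F P"
        if P: "P \<in> pairings (set ys - {ys ! k})" for P
      proof -
        let ?w = "matching_word P"
        have w: "set ?w = set ys - {ys ! k}" "distinct ?w"
          using matching_word_set[OF P] matching_word_distinct[OF P] by simp_all
        have word: "matching_word (insert {x, ys ! k} P) = x # ys ! k # ?w"
          by (rule matching_word_insert[OF P]) (use yk x in auto)
        have "filter (\<lambda>v. v < x) (ys ! k # ?w) = []"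
          unfolding filter_empty_conv using w(1) yk x by fastforce
        moreover have "length (filter (\<lambda>v. v < ys ! k) ?w) = card {v \<in> set ?w. v < ys ! k}"
          using w(2) by (metis distinct_card distinct_filter set_filter)
        moreover have "{v \<in> set ?w. v < ys ! k} = {v \<in> set ys. v < ys ! k}" using w(1) by auto
        ultimately have inv: "inversion_count (x # ys ! k # ?w) = k + inversion_count ?w"
          using card_less_nth[OF sorted k] by simp
        have "{x, ys ! k} \<notin> P" using pairings_insert_pair(2)[OF xn yk P] .
        moreover have "finite P" using P by (auto intro: finite_pairing)
        moreover have "Min {x, ys ! k} = x" "Max {x, ys ! k} = ys ! k" using x[OF yk] by auto
        ultimately show ?thesis by (simp add: word inv power_add mult_ac del: inversion_count.simps)
      qed
      then have "(\<Sum>P\<in>pairings (set ys - {ys ! k}). ?F (insert {x, ys ! k} P))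
        = (- 1) ^ k * a x (ys ! k) * (\<Sum>P\<in>pairings (set ys - {ys ! k}). ?F P)"
        unfolding sum_distrib_left by (intro sum.cong refl)
      also have "(\<Sum>P\<in>pairings (set ys - {ys ! k}). ?F P) = pf_list a (del k ys)"
        using less.hyps[of "del k ys"] strict_sorted_del[OF sorted] k dist
        by (simp add: set_del length_del Cons)
      finally show "(\<Sum>P\<in>pairings (set ys - {ys ! k}). ?F (insert {x, ys ! k} P))
        = (- 1) ^ k * a x (ys ! k) * pf_list a (del k ys)" .
    qed
    finally show ?thesis by (simp add: Cons pf_list.simps(2))
  qed
qed

section \<open>Eliminating two rows at a time over power series\<close>

fun system_coeff where
  "system_coeff c B X d j = fps_nth (c j) d
     + (\<Sum>i\<in>X. \<Sum>m<d. system_coeff c B X m i * fps_nth (B j i) (d - m))"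

declare system_coeff.simps [simp del]

lemma fps_linear_system:
  fixes c :: "'b \<Rightarrow> 'r::comm_ring_1 fps"
  assumes "\<And>i j. fps_nth (B j i) 0 = 0"
  shows "\<exists>z. \<forall>j. z j = c j + (\<Sum>i\<in>X. z i * B j i)"
proof (intro exI allI)
  fix j
  let ?z = "\<lambda>j. Abs_fps (\<lambda>d. system_coeff c B X d j)"
  show "?z j = c j + (\<Sum>i\<in>X. ?z i * B j i)"
  proof (rule fps_ext)
    fix d
    have "fps_nth (?z i * B j i) d = (\<Sum>m<d. system_coeff c B X m i * fps_nth (B j i) (d - m))" for i
    proof -
      have "{0..d} = insert d {..<d}" by auto
      then show ?thesis using assms by (simp add: fps_mult_nth)
    qed
    then show "fps_nth (?z j) d = fps_nth (c j + (\<Sum>i\<in>X. ?z i * B j i)) d"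
      by (simp add: fps_sum_nth system_coeff.simps[of c B X d j])
  qed
qed

text \<open>Partner of an index under \<open>J\<close>. Pairing neighbours, odd with next even,
  keeps every interval from an odd index to the even \<open>n\<close> closed under
  \<open>mate\<close>, so \<open>J\<close> restricts to the rows left after an elimination.\<close>

definition mate :: "nat \<Rightarrow> nat" where
  "mate j = (if odd j then Suc j else j - 1)"

definition standard_form :: "nat \<Rightarrow> nat \<Rightarrow> 'r::comm_ring_1" where
  "standard_form i j = (if odd i \<and> j = Suc i then 1 else if odd j \<and> i = Suc j then - 1 else 0)"

lemma mate_mate: "j \<ge> 1 \<Longrightarrow> mate (mate j) = j"
  by (auto simp: mate_def)

lemma standard_form_mate:
  assumes "i \<ge> 1" "j \<ge> 1"
  shows "standard_form i j = (if i = mate j then (- 1) ^ j else 0)"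
  using assms by (auto simp: standard_form_def mate_def elim: oddE evenE)

context
  fixes x :: "nat \<Rightarrow> nat \<Rightarrow> 'r::comm_ring_1" and l :: "nat \<Rightarrow> nat \<Rightarrow> nat"
  assumes x_skew: "\<And>i j. x i j = - x j i" and x_diag: "\<And>i. x i i = 0"
    and l_sym: "\<And>i j. l i j = l j i" and l_pos: "\<And>i j. 0 < l i j"
begin

definition entry :: "nat \<Rightarrow> nat \<Rightarrow> 'r fps" where
  "entry i j = fps_const (x i j) * fps_X ^ l i j"

definition perturbed :: "nat \<Rightarrow> nat \<Rightarrow> 'r fps" where
  "perturbed i j = standard_form i j + entry i j"

lemma entry_mult_nth:
  "fps_nth (f * entry i j) d = (if d < l i j then 0 else x i j * fps_nth f (d - l i j))"
proof -
  have "f * entry i j = (fps_const (x i j) * f) * fps_X ^ l i j" by (simp add: entry_def mult_ac)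
  then show ?thesis by (simp only: fps_X_power_mult_right_nth fps_mult_left_const_nth)
qed

lemma perturbed_skew: "perturbed i j = - perturbed j i"
  using x_skew[of i j] l_sym[of i j]
  by (auto simp: perturbed_def standard_form_def entry_def simp flip: fps_const_neg)

lemma perturbed_diag: "perturbed i i = 0"
  by (simp add: perturbed_def standard_form_def entry_def x_diag)

text \<open>Moving \<open>J\<close> to the other side of the elimination system gives a fixed-point
  equation for \<open>z\<close> with the small entries as coefficients. The solution is stated for
  \<open>Z = h * z\<close>: seeded with \<open>h\<close>, the same recursion yields the product of
  \<open>h\<close> and the new factor, and every remaining product has a factor
  \<open>entry\<close>.\<close>

lemma pf_series_step:
  assumes k: "odd k" and n: "even n"
  defines "X \<equiv> {k + 2..n}" and "h \<equiv> pf_list perturbed [k + 2..<Suc n]"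
  assumes kn: "Suc k \<le> n"
  shows "\<exists>Z. (\<forall>j\<in>X. Z j = (- 1) ^ j * (h * entry k (mate j) + (\<Sum>i\<in>X. Z i * entry i (mate j)))) \<and>
    pf_list perturbed [k..<Suc n] = h + h * entry k (Suc k) + (\<Sum>i\<in>X. Z i * entry i (Suc k))"
proof -
  have entry0: "fps_nth (entry i j) 0 = 0" for i j
    using l_pos[of i j] by (simp add: entry_def)
  have "fps_nth ((- 1) ^ j * entry i (mate j)) 0 = 0" for i j :: nat
    using entry0 by simp
  then obtain z where z: "\<And>j. z j = (- 1) ^ j * entry k (mate j) + (\<Sum>i\<in>X. z i * ((- 1) ^ j * entry i (mate j)))"
    using fps_linear_system[of "\<lambda>j i. (- 1) ^ j * entry i (mate j)" "\<lambda>j. (- 1) ^ j * entry k (mate j)" X] by blast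
  have z': "z j = (- 1) ^ j * (entry k (mate j) + (\<Sum>i\<in>X. z i * entry i (mate j)))" for j
    by (subst z) (simp add: distrib_left sum_distrib_left mult_ac)
  \<comment> \<open>As \<open>k\<close> is odd and \<open>n\<close> is even, no pair of neighbours
    is split by an end of \<open>X\<close>.\<close>
  have mate_X: "mate j \<in> X" "mate j \<ge> 1" "j \<ge> 1" "(- 1 :: 'r fps) ^ mate j = - ((- 1) ^ j)" if "j \<in> X" for j
  proof -
    have j: "k + 2 \<le> j" "j \<le> n" using that by (auto simp: X_def)
    have "k + 2 \<le> mate j \<and> mate j \<le> n" using j k n unfolding mate_def by (cases "odd j") (simp, presburger)+
    then show "mate j \<in> X" "mate j \<ge> 1" "j \<ge> 1" using j by (auto simp: X_def)
    show "(- 1 :: 'r fps) ^ mate j = - ((- 1) ^ j)" using \<open>j \<ge> 1\<close>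
      by (cases j) (simp_all add: mate_def)
  qed
  have X1: "i \<ge> 1" if "i \<in> X" for i using that by (auto simp: X_def)
  \<comment> \<open>On \<open>X\<close> the form \<open>J\<close> permutes coordinates by
    \<open>mate\<close> up to sign, so inserting the recursion at \<open>mate j\<close> cancels the
    contributions of \<open>entry\<close>. Row \<open>k\<close> of \<open>J\<close> has no nonzero
    column in \<open>X\<close>.\<close>
  have main: "(\<Sum>i\<in>X. z i * perturbed i j) = - perturbed k j" if j: "j \<in> X" for j
  proof -
    have "(\<Sum>i\<in>X. z i * standard_form i j) = (\<Sum>i\<in>X. if i = mate j then z i * (- 1) ^ j else 0)"
      using X1 mate_X(3)[OF j] by (intro sum.cong refl) (simp add: standard_form_mate)
    also have "\<dots> = z (mate j) * (- 1) ^ j" using mate_X[OF j] by (simp add: X_def)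
    also have "\<dots> = - (entry k j + (\<Sum>i\<in>X. z i * entry i j)) * ((- 1) ^ j * (- 1) ^ j)"
      unfolding z'[of "mate j"] mate_mate[OF mate_X(3)[OF j]] mate_X(4)[OF j] by (simp add: mult_ac)
    also have "((- 1) ^ j * (- 1) ^ j :: 'r fps) = 1" by (simp flip: power_mult_distrib)
    finally have "(\<Sum>i\<in>X. z i * standard_form i j) = - (entry k j + (\<Sum>i\<in>X. z i * entry i j))" by simp
    moreover have "perturbed k j = entry k j"
      using j by (auto simp: perturbed_def standard_form_def X_def)
    ultimately show ?thesis by (simp add: perturbed_def distrib_left sum.distrib)
  qed
  have upt: "[k..<Suc n] = k # Suc k # [k + 2..<Suc n]" using kn by (simp add: upt_conv_Cons)
  have setX: "set [k + 2..<Suc n] = X" unfolding X_def by auto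
  have "pf_list perturbed [k..<Suc n]
      = (perturbed k (Suc k) + (\<Sum>i\<in>X. z i * perturbed i (Suc k))) * h"
    unfolding upt h_def
  proof (rule pf_list_schur[OF perturbed_skew perturbed_diag])
    show "X \<subseteq> set [k + 2..<Suc n]" using setX by simp
    show "(\<Sum>i\<in>X. z i * perturbed i j) = - perturbed k j" if "j \<in> set [k + 2..<Suc n]" for j
      using main that unfolding setX by blast
  qed (simp add: X_def)
  also have "perturbed k (Suc k) = 1 + entry k (Suc k)" using k by (simp add: perturbed_def standard_form_def)
  also have "(\<Sum>i\<in>X. z i * perturbed i (Suc k)) = (\<Sum>i\<in>X. z i * entry i (Suc k))"
    using k by (intro sum.cong refl) (auto simp: perturbed_def standard_form_def X_def)
  also have "(1 + entry k (Suc k) + (\<Sum>i\<in>X. z i * entry i (Suc k))) * h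
      = h + h * entry k (Suc k) + (\<Sum>i\<in>X. (h * z i) * entry i (Suc k))"
    by (simp add: algebra_simps sum_distrib_left sum_distrib_right)
  finally have pf: "pf_list perturbed [k..<Suc n] = h + h * entry k (Suc k) + (\<Sum>i\<in>X. (h * z i) * entry i (Suc k))" .
  have hz: "h * z j = (- 1) ^ j * (h * entry k (mate j) + (\<Sum>i\<in>X. (h * z i) * entry i (mate j)))" for j
    by (subst z') (simp add: distrib_left sum_distrib_left mult_ac)
  show ?thesis
    by (rule exI[of _ "\<lambda>j. h * z j"], rule conjI[OF ballI[OF hz] pf])
qed

end

section \<open>Skew circuits\<close>

text \<open>The first input of every multiplication gate is an input gate read by no other gate. The set
  \<open>U\<close> contains gates that later gates may read; it excludes these private inputs.\<close>

definition skew_circuit :: "('v, 'a) circuit \<Rightarrow> nat set \<Rightarrow> bool" where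
  "skew_circuit C U \<longleftrightarrow>
     (\<forall>k<length C. \<forall>i\<in>gate_inputs (C ! k). i < k) \<and> U \<subseteq> {..<length C} \<and>
     (\<forall>k i j. k < length C \<and> C ! k = Mul i j \<longrightarrow>
        i \<noteq> j \<and> gate_inputs (C ! i) = {} \<and> i \<notin> U \<and>
        (\<forall>m<length C. i \<in> gate_inputs (C ! m) \<longrightarrow> m = k))"

lemma circuit_values_snoc:
  "circuit_values (C @ [g]) = circuit_values C @ [gate_value (circuit_values C) g]"
  by (simp add: circuit_values_def)

lemma length_circuit_values [simp]: "length (circuit_values C) = length C"
  by (induction C rule: rev_induct) (simp_all add: circuit_values_snoc, simp add: circuit_values_def)

lemma skew_circuit_snoc:
  assumes C: "skew_circuit C U" and g: "gate_inputs g \<subseteq> U" "\<And>i j. g \<noteq> Mul i j"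
  shows "skew_circuit (C @ [g]) (insert (length C) U)"
proof -
  have U: "i < length C" if "i \<in> U" for i using C that by (auto simp: skew_circuit_def)
  have in_lt: "i < k" if "k < length C" "i \<in> gate_inputs (C ! k)" for k i
    using C that by (auto simp: skew_circuit_def)
  have Mul: "i \<noteq> j" "gate_inputs (C ! i) = {}" "i \<notin> U" "i < k"
      "\<And>m. m < length C \<Longrightarrow> i \<in> gate_inputs (C ! m) \<Longrightarrow> m = k"
    if "k < length C" "C ! k = Mul i j" for k i j
    using C that in_lt[of k i] by (auto simp: skew_circuit_def)
  show ?thesis unfolding skew_circuit_def
  proof (intro conjI allI impI ballI)
    fix k i assume "k < length (C @ [g])" "i \<in> gate_inputs ((C @ [g]) ! k)"
    then show "i < k" using in_lt[of k i] g(1) U by (cases "k = length C") (auto simp: nth_append)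
  next
    show "insert (length C) U \<subseteq> {..<length (C @ [g])}" using U by fastforce
  next
    fix k i j assume *: "k < length (C @ [g]) \<and> (C @ [g]) ! k = Mul i j"
    then have k: "k < length C" "C ! k = Mul i j" using g(2) by (auto simp: nth_append split: if_splits)
    note M = Mul[OF k]
    have i: "i < length C" using M(4) k(1) by simp
    show "i \<noteq> j" by (rule M(1))
    show "gate_inputs ((C @ [g]) ! i) = {}" using M(2) i by (simp add: nth_append)
    show "i \<notin> insert (length C) U" using M(3) i by simp
    fix m assume m: "m < length (C @ [g])" "i \<in> gate_inputs ((C @ [g]) ! m)"
    then have "m < length C" using g(1) M(3) by (cases "m = length C") auto
    then show "m = k" using m M(5)[of m] by (simp add: nth_append)
  qed
qed

text \<open>The multiplication gate brings its own input gate at position \<open>length C\<close>.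
  This position never enters \<open>U\<close>, so no later gate can read it.\<close>

lemma skew_circuit_snoc_private:
  assumes C: "skew_circuit C U" and g: "gate_inputs g = {}" and j: "j \<in> U"
  shows "skew_circuit (C @ [g, Mul (length C) j]) (insert (Suc (length C)) U)"
proof -
  let ?n = "length C"
  have U: "i < length C" if "i \<in> U" for i using C that by (auto simp: skew_circuit_def)
  have in_lt: "i < k" if "k < length C" "i \<in> gate_inputs (C ! k)" for k i
    using C that by (auto simp: skew_circuit_def)
  have Mul: "i \<noteq> j" "gate_inputs (C ! i) = {}" "i \<notin> U" "i < k"
      "\<And>m. m < length C \<Longrightarrow> i \<in> gate_inputs (C ! m) \<Longrightarrow> m = k"
    if "k < length C" "C ! k = Mul i j" for k i j
    using C that in_lt[of k i] by (auto simp: skew_circuit_def)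
  let ?D = "C @ [g, Mul ?n j]"
  have nth: "?D ! k = C ! k" if "k < ?n" for k using that by (simp add: nth_append)
  have nth_n: "?D ! ?n = g" "?D ! Suc ?n = Mul ?n j" by (simp_all add: nth_append)
  have cases: "k < ?n \<or> k = ?n \<or> k = Suc ?n" if "k < length ?D" for k using that by auto
  show ?thesis unfolding skew_circuit_def
  proof (intro conjI allI impI ballI)
    fix k i assume k: "k < length ?D" and i: "i \<in> gate_inputs (?D ! k)"
    show "i < k" using cases[OF k] i in_lt[of k i] g U[OF j] nth nth_n by auto
  next
    show "insert (Suc ?n) U \<subseteq> {..<length ?D}" using U by fastforce
  next
    fix k i j' assume *: "k < length ?D \<and> ?D ! k = Mul i j'"
    then consider "k < ?n" "C ! k = Mul i j'" | "k = Suc ?n" "i = ?n" "j' = j"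
      using cases[of k] nth[of k] nth_n g by auto
    then have "i \<noteq> j' \<and> gate_inputs (?D ! i) = {} \<and> i \<notin> insert (Suc ?n) U \<and>
        (\<forall>m<length ?D. i \<in> gate_inputs (?D ! m) \<longrightarrow> m = k)"
    proof cases
      case 1
      note M = Mul[OF 1]
      have i: "i < ?n" using M(4) 1 by simp
      have "m = k" if "m < length ?D" "i \<in> gate_inputs (?D ! m)" for m
        using cases[OF that(1)] that(2) M(3) M(5)[of m] nth nth_n g i j by auto
      then show ?thesis using M i nth[of i] by auto
    next
      case 2
      have "m = k" if "m < length ?D" "i \<in> gate_inputs (?D ! m)" for m
        using cases[OF that(1)] that(2) in_lt[of m i] nth[of m] nth_n g 2 by auto
      then show ?thesis using 2 U[OF j] U nth_n g by auto
    qed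
    then show "i \<noteq> j'" "gate_inputs (?D ! i) = {}" "i \<notin> insert (Suc ?n) U"
      "\<And>m. m < length ?D \<Longrightarrow> i \<in> gate_inputs (?D ! m) \<Longrightarrow> m = k" by blast+
  qed
qed

text \<open>A gate without inputs is its own subcircuit, and the multiplication gate is its only
  reader.\<close>

lemma skew_circuit_weakly_skew:
  assumes C: "skew_circuit C U" and "C \<noteq> []"
  shows "weakly_skew C"
  unfolding weakly_skew_def
proof (intro conjI allI impI)
  show "wf_circuit C" using assms by (auto simp: wf_circuit_def skew_circuit_def)
  fix k i j assume k: "k < length C \<and> C ! k = Mul i j"
  then have i: "i \<noteq> j" "gate_inputs (C ! i) = {}"
    "\<And>m. m < length C \<Longrightarrow> i \<in> gate_inputs (C ! m) \<Longrightarrow> m = k"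
    using C by (auto simp: skew_circuit_def)
  have "subcircuit C i = {i}"
  proof -
    have "l = i" if "(l, i) \<in> (wires C)\<^sup>*" for l
      using that by (induction rule: converse_rtrancl_induct) (use i(2) in \<open>auto simp: wires_def\<close>)
    then show ?thesis by (auto simp: subcircuit_def)
  qed
  then have "private_input C k i j" using i by (auto simp: private_input_def wires_def)
  then show "private_input C k i j \<or> private_input C k j i" ..
qed

section \<open>Gate counts for families of polynomials\<close>

definition computable :: "nat \<Rightarrow> ('v, 'a::comm_ring_1) mpoly set \<Rightarrow> bool" where
  "computable N S \<longleftrightarrow>
     (\<exists>C U. skew_circuit C U \<and> length C \<le> N \<and> S \<subseteq> (!) (circuit_values C) ` U)"

lemma computable_empty: "computable 0 {}"
  unfolding computable_def by (intro exI[of _ "[]"] exI[of _ "{}"]) (simp add: skew_circuit_def)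

lemma computable_mono: "computable N S \<Longrightarrow> N \<le> N' \<Longrightarrow> S' \<subseteq> S \<Longrightarrow> computable N' S'"
  unfolding computable_def by (meson order_trans)

lemma computable_snoc:
  assumes "skew_circuit C U" "length C \<le> N" "S \<subseteq> (!) (circuit_values C) ` U"
    and g: "gate_inputs g \<subseteq> U" "\<And>i j. g \<noteq> Mul i j"
  shows "computable (Suc N) (insert (gate_value (circuit_values C) g) S)"
  unfolding computable_def
proof (intro exI conjI)
  show "skew_circuit (C @ [g]) (insert (length C) U)" by (rule skew_circuit_snoc[OF assms(1) g])
  show "length (C @ [g]) \<le> Suc N" using assms(2) by simp
  have "circuit_values C ! i = circuit_values (C @ [g]) ! i" if "i \<in> U" for i
    using assms(1) that by (auto simp: circuit_values_snoc nth_append skew_circuit_def)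
  then have "S \<subseteq> (!) (circuit_values (C @ [g])) ` U" using assms(3) by (auto simp: image_iff)
  then show "insert (gate_value (circuit_values C) g) S \<subseteq> (!) (circuit_values (C @ [g])) ` insert (length C) U"
    by (auto simp: circuit_values_snoc nth_append)
qed

lemma computable_const: "computable N S \<Longrightarrow> computable (Suc N) (insert (mconst c) S)"
  unfolding computable_def[of N S] by (elim exE conjE) (drule (2) computable_snoc[where g = "Const c"], simp_all)

lemma computable_add:
  assumes "computable N S" "f \<in> S" "g \<in> S"
  shows "computable (Suc N) (insert (f + g) S)"
proof -
  obtain C U where C: "skew_circuit C U" "length C \<le> N" "S \<subseteq> (!) (circuit_values C) ` U"
    using assms(1) unfolding computable_def by blast
  then obtain i j where "i \<in> U" "f = circuit_values C ! i" "j \<in> U" "g = circuit_values C ! j"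
    using assms(2,3) by blast
  then show ?thesis using computable_snoc[OF C, of "Add i j"] by simp
qed

lemma computable_mult_input:
  assumes "computable N S" "f \<in> S" and p: "p = mconst c \<or> p = mvar v"
  shows "computable (N + 2) (insert (p * f) S)"
proof -
  obtain C U where C: "skew_circuit C U" "length C \<le> N" "S \<subseteq> (!) (circuit_values C) ` U"
    using assms(1) unfolding computable_def by blast
  then obtain j where j: "j \<in> U" "f = circuit_values C ! j" using assms(2) by blast
  obtain g where g: "gate_inputs g = {}" "\<And>vs. gate_value vs g = p"
    using p by (metis gate_inputs.simps(1,2) gate_value.simps(1,2))
  let ?D = "C @ [g, Mul (length C) j]"
  have U: "i < length C" if "i \<in> U" for i using C(1) that by (auto simp: skew_circuit_def)
  have D: "?D = (C @ [g]) @ [Mul (length C) j]" by simp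
  have vals: "circuit_values ?D = circuit_values C @ [p, p * f]"
    unfolding D circuit_values_snoc using g j U by (simp add: nth_append)
  show ?thesis unfolding computable_def
  proof (intro exI conjI)
    show "skew_circuit ?D (insert (Suc (length C)) U)" by (rule skew_circuit_snoc_private[OF C(1) g(1) j(1)])
    show "length ?D \<le> N + 2" using C(2) by simp
    have "circuit_values C ! i = circuit_values ?D ! i" if "i \<in> U" for i
      using U[OF that] by (simp add: vals nth_append)
    then have "S \<subseteq> (!) (circuit_values ?D) ` U" using C(3) by (auto simp: image_iff)
    then show "insert (p * f) S \<subseteq> (!) (circuit_values ?D) ` insert (Suc (length C)) U"
      by (auto simp: vals nth_append)
  qed
qed

text \<open>The output must be the last gate, but \<open>f\<close> may sit anywhere in
  \<open>U\<close>. Adding the constant 0 moves it to the end for two gates.\<close>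

lemma computable_weakly_skew:
  assumes "computable N {f}"
  obtains C where "weakly_skew C" "circuit_poly C = f" "length C \<le> N + 2"
proof -
  obtain C U where C: "skew_circuit C U" "length C \<le> N" "f \<in> (!) (circuit_values C) ` U"
    using assms unfolding computable_def by auto
  then obtain i where i: "i \<in> U" "f = circuit_values C ! i" by blast
  have il: "i < length C" using C(1) i by (auto simp: skew_circuit_def)
  let ?D = "(C @ [Const 0]) @ [Add i (length C)]"
  have "skew_circuit (C @ [Const 0]) (insert (length C) U)"
    by (rule skew_circuit_snoc[OF C(1)]) simp_all
  then have "skew_circuit ?D (insert (length (C @ [Const 0])) (insert (length C) U))"
    by (rule skew_circuit_snoc) (use i in simp_all)
  then have "weakly_skew ?D" by (rule skew_circuit_weakly_skew) simp
  moreover have "circuit_poly ?D = f"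
    unfolding circuit_poly_def circuit_values_snoc using i il by (simp add: nth_append mconst_def)
  moreover have "length ?D \<le> N + 2" using C(2) by simp
  ultimately show ?thesis by (rule that)
qed

definition input_label :: "('v, 'a::comm_ring_1) mpoly \<Rightarrow> bool" where
  "input_label p \<longleftrightarrow> (\<exists>c v. p = mconst c \<or> p = mconst c * mvar v)"

lemma computable_mult_label:
  assumes "computable N S" "f \<in> S" "input_label p"
  shows "computable (N + 4) (insert (p * f) S)"
proof -
  obtain c v where p: "p = mconst c \<or> p = mconst c * mvar v" using assms(3) by (auto simp: input_label_def)
  then show ?thesis
  proof
    assume "p = mconst c"
    then show ?thesis using computable_mult_input[OF assms(1,2), of p c] by (auto intro: computable_mono)
  next
    assume p: "p = mconst c * mvar v"
    have "computable (N + 2) (insert (mvar v * f) S)"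
      by (rule computable_mult_input[OF assms(1,2) disjI2[OF refl]])
    then have "computable (N + 2 + 2) (insert (mconst c * (mvar v * f)) (insert (mvar v * f) S))"
      by (rule computable_mult_input[OF _ _ disjI1[OF refl]]) simp
    then show ?thesis by (rule computable_mono) (auto simp: p mult.assoc)
  qed
qed

definition label_combination :: "nat \<Rightarrow> ('v, 'a::comm_ring_1) mpoly set \<Rightarrow> ('v, 'a) mpoly \<Rightarrow> bool" where
  "label_combination L S f \<longleftrightarrow> (\<exists>ps. length ps \<le> L \<and> (\<forall>(p, g)\<in>set ps. input_label p \<and> g \<in> S) \<and>
     f = (\<Sum>(p, g)\<leftarrow>ps. p * g))"

text \<open>A term takes four gates for its label, since constant and variable each need a private
  copy and a multiplication, and one gate for the addition. The last gate is the zero that starts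
  the sum.\<close>

lemma computable_combination:
  assumes "computable N S" "label_combination L S f"
  shows "computable (N + (5 * L + 1)) (insert f S)"
proof -
  obtain ps where ps: "length ps \<le> L" "\<forall>(p, g)\<in>set ps. input_label p \<and> g \<in> S" "f = (\<Sum>(p, g)\<leftarrow>ps. p * g)"
    using assms(2) by (auto simp: label_combination_def)
  have "computable (N + (5 * length ps + 1)) (insert (\<Sum>(p, g)\<leftarrow>ps. p * g) S)"
    using ps(2)
  proof (induction ps)
    case Nil
    show ?case using computable_const[OF assms(1), of 0] by (simp add: mconst_def)
  next
    case (Cons q ps)
    obtain p g where q: "q = (p, g)" by (cases q)
    have p: "input_label p" "g \<in> S" using Cons.prems q by auto
    let ?s = "\<Sum>(p, g)\<leftarrow>ps. p * g"
    have "computable (N + (5 * length ps + 1)) (insert ?s S)" using Cons by simp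
    from computable_mult_label[OF this _ p(1), of g]
    have "computable (N + (5 * length ps + 1) + 4) (insert (p * g) (insert ?s S))" using p by simp
    from computable_add[OF this, of "p * g" ?s]
    have "computable (Suc (N + (5 * length ps + 1) + 4)) (insert (p * g + ?s) (insert (p * g) (insert ?s S)))"
      by simp
    then show ?case by (rule computable_mono) (auto simp: q)
  qed
  then show ?thesis by (rule computable_mono) (use ps in auto)
qed

lemma label_combination_mono:
  "label_combination L S f \<Longrightarrow> L \<le> L' \<Longrightarrow> S \<subseteq> S' \<Longrightarrow> label_combination L' S' f"
  unfolding label_combination_def
  by (elim exE conjE, rename_tac ps, rule_tac x = ps in exI) auto

lemma label_combination_add:
  "label_combination L S f \<Longrightarrow> label_combination L' S f' \<Longrightarrow> label_combination (L + L') S (f + f')"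
  unfolding label_combination_def
  by (elim exE conjE, rename_tac ps ps', rule_tac x = "ps @ ps'" in exI) auto

lemma label_combination_zero: "label_combination 0 S 0"
  unfolding label_combination_def by (intro exI[of _ "[]"]) simp

lemma label_combination_single: "input_label p \<Longrightarrow> g \<in> S \<Longrightarrow> label_combination 1 S (p * g)"
  unfolding label_combination_def by (intro exI[of _ "[(p, g)]"]) simp

lemma label_combination_sum:
  assumes "finite I" "\<And>i. i \<in> I \<Longrightarrow> label_combination 1 S (f i)"
  shows "label_combination (card I) S (\<Sum>i\<in>I. f i)"
  using assms
proof (induction I rule: finite_induct)
  case empty
  show ?case by (simp add: label_combination_zero)
next
  case (insert i I)
  have "label_combination (1 + card I) S (f i + (\<Sum>i\<in>I. f i))"
    using insert by (intro label_combination_add) auto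
  then show ?case using insert by simp
qed

text \<open>The polynomials of \<open>S\<close> are shared by all combinations, so the costs add up
  rather than multiply. This reuse is the reason for speaking of whole sets of available
  polynomials.\<close>

lemma computable_combinations:
  assumes "computable N S" "finite T" "\<And>f. f \<in> T \<Longrightarrow> label_combination L S f"
  shows "computable (N + card T * (5 * L + 1)) (T \<union> S)"
  using assms(2,3)
proof (induction T rule: finite_induct)
  case empty
  show ?case using assms(1) by simp
next
  case (insert f T)
  have "label_combination L (T \<union> S) f" using insert by (auto intro: label_combination_mono)
  from computable_combination[OF insert.IH this] insert
  show ?case by (simp add: add_ac)
qed

section \<open>Circuits for the coefficients of the perturbed Pfaffian\<close>

lemma mconst_minus: "- mconst c = mconst (- c)"
  by (simp add: mconst_def single_uminus)

lemma input_label_minus: "input_label p \<Longrightarrow> input_label (- p)"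
  unfolding input_label_def by (metis mconst_minus minus_mult_left)

lemma input_label_sign: "input_label p \<Longrightarrow> input_label ((- 1) ^ j * p)"
  by (cases "even j") (simp_all add: input_label_minus)

lemma input_label_zero: "input_label 0"
  unfolding input_label_def by (intro exI[of _ 0]) (simp add: mconst_def)

lemma input_label_one: "input_label 1"
  unfolding input_label_def by (intro exI[of _ 1]) (simp add: mconst_def)

lemma fps_nth_sign_mult: "fps_nth ((- 1) ^ j * f) d = (- 1) ^ j * fps_nth f d"
  for f :: "'r::comm_ring_1 fps"
  by (cases "even j") simp_all

context
  fixes x :: "nat \<Rightarrow> nat \<Rightarrow> ('v, 'a::comm_ring_1) mpoly" and l :: "nat \<Rightarrow> nat \<Rightarrow> nat"
  assumes x_skew: "\<And>i j. x i j = - x j i" and x_diag: "\<And>i. x i i = 0"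
    and l_sym: "\<And>i j. l i j = l j i" and l_pos: "\<And>i j. 0 < l i j"
    and x_label: "\<And>i j. input_label (x i j)"
begin

text \<open>Every entry has positive degree in \<open>t\<close>, so only strictly smaller degrees of
  \<open>f\<close> are read. This is what permits evaluation degree by degree.\<close>

lemma label_combination_entry:
  assumes "\<And>d'. d' < d \<Longrightarrow> fps_nth f d' \<in> S"
  shows "label_combination 1 S ((- 1) ^ j * fps_nth (f * entry x l i i') d)"
proof (cases "d < l i i'")
  case True
  have "label_combination 1 S 0" by (rule label_combination_mono[OF label_combination_zero]) auto
  then show ?thesis using True by (simp add: entry_mult_nth[OF x_skew x_diag l_sym l_pos])
next
  case False
  have "fps_nth f (d - l i i') \<in> S" using assms False l_pos[of i i'] by simp
  then have "label_combination 1 S (((- 1) ^ j * x i i') * fps_nth f (d - l i i'))"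
    by (intro label_combination_single input_label_sign x_label)
  then show ?thesis using False by (simp add: entry_mult_nth[OF x_skew x_diag l_sym l_pos] mult.assoc)
qed

text \<open>For each of the \<open>K + 1\<close> degrees there are at most \<open>n\<close>
  coefficients of \<open>Z\<close> with at most \<open>n + 1\<close> terms each, and one coefficient
  of the new Pfaffian with at most \<open>n + 2\<close> terms.\<close>

lemma computable_pf_series_step:
  assumes k: "odd k" and n: "even n" and kn: "Suc k \<le> n"
    and h: "computable N (fps_nth (pf_list (perturbed x l) [k + 2..<Suc n]) ` {..K})"
  shows "computable (N + (K + 1) * ((n + 1) * (5 * n + 15)))
    (fps_nth (pf_list (perturbed x l) [k..<Suc n]) ` {..K})"
proof -
  define X where "X = {k + 2..n}"
  define h where "h = pf_list (perturbed x l) [k + 2..<Suc n]"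
  define h' where "h' = pf_list (perturbed x l) [k..<Suc n]"
  obtain Z where Z: "\<And>j. j \<in> X \<Longrightarrow> Z j = (- 1) ^ j * (h * entry x l k (mate j) + (\<Sum>i\<in>X. Z i * entry x l i (mate j)))"
    and h': "h' = h + h * entry x l k (Suc k) + (\<Sum>i\<in>X. Z i * entry x l i (Suc k))"
    using pf_series_step[of x l, OF x_skew x_diag l_sym l_pos k n kn] unfolding X_def h_def h'_def by blast
  have cardX: "card X \<le> n" and finX: "finite X" by (simp_all add: X_def)
  define H where "H = fps_nth h ` {..K}"
  define ZS where "ZS D = (\<lambda>(j, d). fps_nth (Z j) d) ` (X \<times> {..<D})" for D
  have Z_nth: "fps_nth (Z j) d = (- 1) ^ j * fps_nth (h * entry x l k (mate j)) d
      + (\<Sum>i\<in>X. (- 1) ^ j * fps_nth (Z i * entry x l i (mate j)) d)" if "j \<in> X" for j d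
    by (subst Z[OF that]) (simp add: fps_nth_sign_mult fps_sum_nth distrib_left sum_distrib_left)
  have in_H: "fps_nth h d \<in> H" if "d \<le> K" for d using that by (simp add: H_def)
  have in_ZS: "fps_nth (Z i) d \<in> ZS D" if "d < D" "i \<in> X" for d i D
    using that by (force simp: ZS_def)
  have "computable (N + D * (n * (5 * (n + 1) + 1))) (ZS D \<union> H)" if "D \<le> Suc K" for D
    using that
  proof (induction D)
    case 0
    then show ?case using h by (simp add: ZS_def H_def h_def)
  next
    case (Suc D)
    define T where "T = (\<lambda>j. fps_nth (Z j) D) ` X"
    have comb: "label_combination (n + 1) (ZS D \<union> H) f" if f: "f \<in> T" for f
    proof -
      obtain j where j: "j \<in> X" "f = fps_nth (Z j) D" using f by (auto simp: T_def)
      have "label_combination (1 + card X) (ZS D \<union> H) (fps_nth (Z j) D)"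
        unfolding Z_nth[OF j(1)]
        using Suc.prems in_H in_ZS
        by (intro label_combination_add label_combination_sum finX label_combination_entry) auto
      then show ?thesis using j cardX by (auto intro: label_combination_mono)
    qed
    have "computable (N + D * (n * (5 * (n + 1) + 1)) + card T * (5 * (n + 1) + 1)) (T \<union> (ZS D \<union> H))"
      by (rule computable_combinations[OF _ _ comb]) (use Suc finX in \<open>auto simp: T_def\<close>)
    then show ?case
    proof (rule computable_mono)
      have "card T \<le> n" using card_image_le[OF finX] cardX unfolding T_def by (rule order_trans)
      then have "card T * (5 * (n + 1) + 1) \<le> n * (5 * (n + 1) + 1)" by (rule mult_le_mono1)
      then show "N + D * (n * (5 * (n + 1) + 1)) + card T * (5 * (n + 1) + 1)
          \<le> N + Suc D * (n * (5 * (n + 1) + 1))" by simp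
      have "ZS (Suc D) = T \<union> ZS D" by (auto simp: ZS_def T_def less_Suc_eq)
      then show "ZS (Suc D) \<union> H \<subseteq> T \<union> (ZS D \<union> H)" by auto
    qed
  qed
  from this[of "Suc K"] have ZH: "computable (N + Suc K * (n * (5 * (n + 1) + 1))) (ZS (Suc K) \<union> H)" by simp
  define T where "T = fps_nth h' ` {..K}"
  have comb: "label_combination (n + 2) (ZS (Suc K) \<union> H) f" if f: "f \<in> T" for f
  proof -
    obtain d where d: "d \<le> K" "f = fps_nth h' d" using f by (auto simp: T_def)
    \<comment> \<open>The factors \<open>1\<close> and \<open>(- 1) ^ 0\<close> only bring the terms
      into the form of labelled products.\<close>
    have "label_combination 1 (ZS (Suc K) \<union> H) (1 * fps_nth h d)"
      using in_H d by (intro label_combination_single input_label_one) auto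
    moreover have "label_combination 1 (ZS (Suc K) \<union> H) ((- 1) ^ 0 * fps_nth (h * entry x l k (Suc k)) d)"
      using in_H d by (intro label_combination_entry) auto
    moreover have "label_combination (card X) (ZS (Suc K) \<union> H)
        (\<Sum>i\<in>X. (- 1) ^ 0 * fps_nth (Z i * entry x l i (Suc k)) d)"
      using in_ZS d by (intro label_combination_sum finX label_combination_entry) auto
    ultimately have "label_combination (1 + 1 + card X) (ZS (Suc K) \<union> H)
       (1 * fps_nth h d + (- 1) ^ 0 * fps_nth (h * entry x l k (Suc k)) d
         + (\<Sum>i\<in>X. (- 1) ^ 0 * fps_nth (Z i * entry x l i (Suc k)) d))"
      by (intro label_combination_add)
    moreover have "f = 1 * fps_nth h d + (- 1) ^ 0 * fps_nth (h * entry x l k (Suc k)) d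
         + (\<Sum>i\<in>X. (- 1) ^ 0 * fps_nth (Z i * entry x l i (Suc k)) d)"
      by (simp add: d h' fps_sum_nth)
    ultimately show ?thesis using cardX by (auto intro: label_combination_mono)
  qed
  have "computable (N + Suc K * (n * (5 * (n + 1) + 1)) + card T * (5 * (n + 2) + 1)) (T \<union> (ZS (Suc K) \<union> H))"
    by (rule computable_combinations[OF ZH _ comb]) (simp add: T_def)
  then show ?thesis
  proof (rule computable_mono)
    have "card T \<le> Suc K" using card_image_le[of "{..K}" "fps_nth h'"] by (simp add: T_def)
    then have "card T * (5 * (n + 2) + 1) \<le> Suc K * (5 * (n + 2) + 1)" by (rule mult_le_mono1)
    moreover have "Suc K * (n * (5 * (n + 1) + 1) + (5 * (n + 2) + 1)) \<le> Suc K * ((n + 1) * (5 * n + 15))"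
      by (intro mult_le_mono2) (simp add: algebra_simps)
    ultimately show "N + Suc K * (n * (5 * (n + 1) + 1)) + card T * (5 * (n + 2) + 1)
        \<le> N + (K + 1) * ((n + 1) * (5 * n + 15))"
      by (simp only: distrib_left Suc_eq_plus1 [symmetric])
    show "fps_nth (pf_list (perturbed x l) [k..<Suc n]) ` {..K} \<subseteq> T \<union> (ZS (Suc K) \<union> H)"
      by (auto simp: T_def h'_def)
  qed
qed

lemma computable_pf_series:
  assumes n: "even n"
  shows "computable (2 + n * ((K + 1) * ((n + 1) * (5 * n + 15))))
    (fps_nth (pf_list (perturbed x l) [1..<Suc n]) ` {..K})"
proof -
  define step where "step = (K + 1) * ((n + 1) * (5 * n + 15))"
  have "computable (2 + m * step) (fps_nth (pf_list (perturbed x l) [n + 1 - 2 * m..<Suc n]) ` {..K})"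
    if "2 * m \<le> n" for m
    using that
  proof (induction m)
    case 0
    \<comment> \<open>No rows are left: the Pfaffian is the series 1, whose coefficients are the two
      constants 1 and 0.\<close>
    have "computable (Suc (Suc 0)) (insert (mconst 1) (insert (mconst 0) {} :: ('v, 'a) mpoly set))"
      by (intro computable_const computable_empty)
    then show ?case
      by (rule computable_mono) (auto simp: mconst_def)
  next
    case (Suc m)
    define k where "k = n + 1 - 2 * Suc m"
    have k: "odd k" "Suc k \<le> n" "k + 2 = n + 1 - 2 * m" using n Suc.prems by (auto simp: k_def)
    have "computable (2 + m * step) (fps_nth (pf_list (perturbed x l) [k + 2..<Suc n]) ` {..K})"
      unfolding k(3) using Suc by simp
    from computable_pf_series_step[OF k(1) n k(2) this]
    show ?case by (simp add: step_def k_def add_ac)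
  qed
  from this[of "n div 2"] have "computable (2 + (n div 2) * step) (fps_nth (pf_list (perturbed x l) [1..<Suc n]) ` {..K})"
    using n by simp
  then show ?thesis
  proof (rule computable_mono)
    have "n div 2 * step \<le> n * step" by (intro mult_le_mono1) simp
    then show "2 + n div 2 * step \<le> 2 + n * ((K + 1) * ((n + 1) * (5 * n + 15)))" by (simp only: step_def)
  qed simp
qed

end

section \<open>Restriction of the Pfaffian to a face\<close>

definition matching_monomial :: "'v set \<Rightarrow> ('v \<Rightarrow>\<^sub>0 nat)" where
  "matching_monomial P = (\<Sum>e\<in>P. Poly_Mapping.single e 1)"

lemma lookup_matching_monomial:
  "finite P \<Longrightarrow> Poly_Mapping.lookup (matching_monomial P) e = (if e \<in> P then 1 else 0)"
proof -
  assume "finite P"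
  have "Poly_Mapping.lookup (matching_monomial P) e = (\<Sum>e'\<in>P. if e' = e then 1 else 0)"
    unfolding matching_monomial_def lookup_sum by (intro sum.cong) (auto simp: lookup_single when_def)
  then show ?thesis using \<open>finite P\<close> by simp
qed

lemma prod_mvar: "finite P \<Longrightarrow> (\<Prod>e\<in>P. mvar e) = Poly_Mapping.single (matching_monomial P) (1 :: 'a::comm_ring_1)"
  by (induction P rule: finite_induct) (simp_all add: matching_monomial_def mvar_def mult_single)

lemma of_int_mult_single:
  "of_int k * Poly_Mapping.single m (1 :: 'a::comm_ring_1) = Poly_Mapping.single (m :: 'v \<Rightarrow>\<^sub>0 nat) (of_int k)"
proof -
  have "(of_int k :: ('v \<Rightarrow>\<^sub>0 nat) \<Rightarrow>\<^sub>0 'a) = Poly_Mapping.single 0 (of_int k)"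
    by (rule single_of_int[symmetric])
  then show ?thesis by (simp only: mult_single add_0 mult_1_right)
qed

lemma exponent_point_matching:
  assumes "finite P"
  shows "exponent_point (matching_monomial P) = (\<Sum>e\<in>P. Poly_Mapping.single e (1::real))"
proof (rule poly_mapping_eqI)
  fix e
  have "Poly_Mapping.lookup (\<Sum>e\<in>P. Poly_Mapping.single e (1::real)) e = (\<Sum>e'\<in>P. if e' = e then 1 else 0)"
    unfolding lookup_sum by (intro sum.cong) (auto simp: lookup_single when_def)
  then show "Poly_Mapping.lookup (exponent_point (matching_monomial P)) e
      = Poly_Mapping.lookup (\<Sum>e\<in>P. Poly_Mapping.single e (1::real)) e"
    using assms by (simp add: exponent_point_def Poly_Mapping.map.rep_eq lookup_matching_monomial when_def)
qed

lemma matching_sign_cases: "matching_sign n P = 1 \<or> matching_sign n P = - 1"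
  unfolding matching_sign_def using sign_cases by metis

text \<open>Different matchings have different monomials and their coefficients are signs, which are
  nonzero in every field. Nothing cancels, so the exponent vectors are exactly the indicator vectors
  of perfect matchings.\<close>

lemma restrict_tutte_pfaffian:
  fixes E :: "nat set set"
  assumes G: "simple_graph n E"
  defines "f \<equiv> tutte_pfaffian n E :: (nat set, 'a::field) mpoly"
  shows "Poly_Mapping.keys f = matching_monomial ` perfect_matchings n E" (is ?keys)
    "restrict_poly f Q = (\<Sum>P | P \<in> perfect_matchings n E \<and> exponent_point (matching_monomial P) \<in> Q.
        of_int (matching_sign n P) * (\<Prod>e\<in>P. mvar e))" (is ?restrict)
proof -
  let ?PM = "perfect_matchings n E"
  have fin: "finite P" if "P \<in> ?PM" for P using perfect_matching_card(3)[OF G that] .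
  have finPM: "finite ?PM"
  proof (rule finite_subset)
    show "?PM \<subseteq> Pow (complete_edges n)" using G by (auto simp: perfect_matchings_def simple_graph_def)
  qed (simp add: finite_complete_edges)
  have inj: "inj_on matching_monomial ?PM"
  proof (rule inj_onI)
    fix P P' assume P: "P \<in> ?PM" "P' \<in> ?PM" "matching_monomial P = matching_monomial P'"
    have "e \<in> P \<longleftrightarrow> e \<in> P'" for e
    proof -
      have "(if e \<in> P then 1 else 0 :: nat) = Poly_Mapping.lookup (matching_monomial P) e"
        by (rule lookup_matching_monomial[OF fin[OF P(1)], symmetric])
      also have "\<dots> = Poly_Mapping.lookup (matching_monomial P') e" by (simp only: P(3))
      also have "\<dots> = (if e \<in> P' then 1 else 0)"
        by (rule lookup_matching_monomial[OF fin[OF P(2)]])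
      finally show ?thesis by (cases "e \<in> P"; cases "e \<in> P'") simp_all
    qed
    then show "P = P'" by blast
  qed
  define s where "s P = (of_int (matching_sign n P) :: 'a)" for P
  have term_eq: "of_int (matching_sign n P) * (\<Prod>e\<in>P. mvar e) = Poly_Mapping.single (matching_monomial P) (s P)"
    if "P \<in> ?PM" for P
    using prod_mvar[OF fin[OF that], where 'a = 'a] by (simp add: of_int_mult_single s_def)
  have f: "f = (\<Sum>P\<in>?PM. Poly_Mapping.single (matching_monomial P) (s P))"
    unfolding f_def tutte_pfaffian_eq[OF G] by (intro sum.cong refl term_eq)
  have s0: "s P \<noteq> 0" for P using matching_sign_cases[of n P] by (auto simp: s_def)
  have lookup_f: "Poly_Mapping.lookup f m = (\<Sum>P\<in>?PM. if matching_monomial P = m then s P else 0)" for m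
    unfolding f lookup_sum by (intro sum.cong) (auto simp: lookup_single when_def)
  have lookup_P: "Poly_Mapping.lookup f (matching_monomial P) = s P" if "P \<in> ?PM" for P
  proof -
    have "Poly_Mapping.lookup f (matching_monomial P) = (\<Sum>P'\<in>?PM. if P' = P then s P' else 0)"
      unfolding lookup_f using inj that by (intro sum.cong refl) (auto dest: inj_onD)
    then show ?thesis using finPM that by simp
  qed
  show keys: ?keys
  proof (rule equalityI; rule subsetI)
    fix m assume "m \<in> Poly_Mapping.keys f"
    then have "Poly_Mapping.lookup f m \<noteq> 0" by (simp add: in_keys_iff)
    then have "\<not> (\<forall>P\<in>?PM. (if matching_monomial P = m then s P else 0) = 0)"
      unfolding lookup_f by (rule contrapos_nn) (rule sum.neutral)
    then show "m \<in> matching_monomial ` ?PM" by (auto split: if_splits)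
  next
    fix m assume "m \<in> matching_monomial ` ?PM"
    then obtain P where "P \<in> ?PM" "m = matching_monomial P" by blast
    then show "m \<in> Poly_Mapping.keys f" using lookup_P s0 by (simp add: in_keys_iff)
  qed
  have "{m. m \<in> Poly_Mapping.keys f \<and> exponent_point m \<in> Q}
      = matching_monomial ` {P. P \<in> ?PM \<and> exponent_point (matching_monomial P) \<in> Q}"
    unfolding keys by blast
  then have "restrict_poly f Q = (\<Sum>P | P \<in> ?PM \<and> exponent_point (matching_monomial P) \<in> Q.
      Poly_Mapping.single (matching_monomial P) (Poly_Mapping.lookup f (matching_monomial P)))"
    unfolding restrict_poly_def by (simp add: sum.reindex inj_on_subset[OF inj] subset_eq)
  also have "\<dots> = (\<Sum>P | P \<in> ?PM \<and> exponent_point (matching_monomial P) \<in> Q.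
        of_int (matching_sign n P) * (\<Prod>e\<in>P. mvar e))"
    by (intro sum.cong refl) (simp add: lookup_P term_eq)
  finally show ?restrict .
qed

text \<open>The exponent point of a matching is a sum of unit vectors, so the functional defining
  the face amounts to an edge weight, namely its values on the unit vectors.\<close>

lemma face_of_tutte_pfaffian:
  fixes E :: "nat set set"
  assumes G: "simple_graph n E"
    and face: "is_face Q (NPT (tutte_pfaffian n E :: (nat set, 'a::field) mpoly))"
  obtains w :: "nat set \<Rightarrow> real" and c
  where "\<And>P. P \<in> perfect_matchings n E \<Longrightarrow> c \<le> sum w P"
    "restrict_poly (tutte_pfaffian n E :: (nat set, 'a) mpoly) Q
      = (\<Sum>P | P \<in> perfect_matchings n E \<and> sum w P = c. of_int (matching_sign n P) * (\<Prod>e\<in>P. mvar e))"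
proof -
  let ?N = "NPT (tutte_pfaffian n E :: (nat set, 'a) mpoly)"
  obtain lf :: "(nat set \<Rightarrow>\<^sub>0 real) \<Rightarrow> real" and c where lf: "linear lf" "\<forall>v\<in>?N. c \<le> lf v" "Q = ?N \<inter> {v. lf v = c}"
    using face unfolding is_face_def by blast
  define w where "w e = lf (Poly_Mapping.single e 1)" for e
  have val: "lf (exponent_point (matching_monomial P)) = sum w P" if "P \<in> perfect_matchings n E" for P
    using perfect_matching_card(3)[OF G that] by (simp add: exponent_point_matching linear_sum[OF lf(1)] w_def)
  have inN: "exponent_point (matching_monomial P) \<in> ?N" if "P \<in> perfect_matchings n E" for P
    unfolding NPT_def restrict_tutte_pfaffian(1)[OF G] using that by (intro hull_inc) blast
  show thesis
  proof (rule that)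
    show "c \<le> sum w P" if "P \<in> perfect_matchings n E" for P
      using lf(2) inN[OF that] val[OF that] by fastforce
    have "{P. P \<in> perfect_matchings n E \<and> exponent_point (matching_monomial P) \<in> Q}
        = {P. P \<in> perfect_matchings n E \<and> sum w P = c}"
      using val inN unfolding lf(3) by auto
    then show "restrict_poly (tutte_pfaffian n E :: (nat set, 'a) mpoly) Q
      = (\<Sum>P | P \<in> perfect_matchings n E \<and> sum w P = c. of_int (matching_sign n P) * (\<Prod>e\<in>P. mvar e))"
      unfolding restrict_tutte_pfaffian(2)[OF G] by simp
  qed
qed

lemma tutte_matrix_label: "input_label (tutte_matrix E i j)"
proof -
  have "input_label (mvar v)" for v :: "nat set"
    unfolding input_label_def by (intro exI[of _ 1] exI[of _ v] disjI2) (simp add: mconst_def)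
  then show ?thesis by (auto simp: tutte_matrix_def input_label_zero intro: input_label_minus)
qed

lemma tutte_matrix_skew: "tutte_matrix E i j = - tutte_matrix E j i"
  by (auto simp: tutte_matrix_def insert_commute)

section \<open>Coefficient extraction and the final size bound\<close>

lemma fps_const_prod: "(\<Prod>i\<in>I. fps_const (f i)) = fps_const (\<Prod>i\<in>I. f i)"
  by (induction I rule: infinite_finite_induct) simp_all

lemma standard_form_const: "standard_form i j = fps_const (standard_form i j)"
  by (simp add: standard_form_def)

lemma fps_nth_monomial: "fps_nth (fps_const c * fps_X ^ s) K = (if s = K then c else 0)"
  by (auto simp: fps_X_power_nth)

text \<open>Edges carry degree about \<open>L\<close>, so in degree \<open>card P * L + sum b P0\<close> the matching \<open>P\<close> contributes
  only the term in which no factor comes from the standard form.\<close>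

lemma perturbed_pf_coefficient:
  fixes b :: "nat set \<Rightarrow> int" and x :: "nat \<Rightarrow> nat \<Rightarrow> 'r::comm_ring_1"
  assumes x_skew: "\<And>i j. x i j = - x j i" and x_diag: "\<And>i. x i i = 0"
    and b: "\<And>e. \<bar>b e\<bar> \<le> int N" and P: "finite P" "\<And>e. e \<in> P \<Longrightarrow> e = {Min e, Max e}"
    and b0: "\<bar>b0\<bar> \<le> int (card P * N)"
    and L: "L = 2 * card P * N + N + 1"
  defines "l \<equiv> \<lambda>i j. nat (b {i, j} + int L)"
  shows "fps_nth (\<Prod>e\<in>P. perturbed x l (Min e) (Max e)) (nat (int (card P * L) + b0))
    = (if sum b P = b0 then \<Prod>e\<in>P. x (Min e) (Max e) else 0)"
proof -
  have bL: "b e + int L > 0" for e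
  proof -
    have "0 \<le> int (2 * card P * N)" by simp
    then show ?thesis using b[of e] unfolding L by linarith
  qed
  have l_sym: "l i j = l j i" for i j by (simp add: l_def insert_commute)
  have l_pos: "0 < l i j" for i j using bL by (simp add: l_def)
  define K where "K = nat (int (card P * L) + b0)"
  \<comment> \<open>\<open>b0\<close> may be negative; \<open>L >= N\<close> keeps the argument of
    \<open>nat\<close> nonnegative.\<close>
  have KI: "int K = int (card P) * int L + b0"
  proof -
    have "card P * N \<le> card P * L" unfolding L by (intro mult_le_mono2) simp
    then have "int (card P * N) \<le> int (card P * L)" by (simp only: of_nat_le_iff)
    then show ?thesis using b0 unfolding K_def by simp
  qed
  define xe where "xe e = x (Min e) (Max e)" for e
  define je where "je e = (standard_form (Min e) (Max e) :: 'r)" for e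
  define le where "le e = l (Min e) (Max e)" for e
  have sum_le: "int (sum le M) = sum b M + int (card M) * int L" if "M \<subseteq> P" for M
  proof -
    have "int (le e) = b e + int L" if "e \<in> M" for e
    proof -
      have "{Min e, Max e} = e" using P(2) that \<open>M \<subseteq> P\<close> by blast
      then show ?thesis using bL[of e] by (simp add: le_def l_def)
    qed
    then show ?thesis by (simp add: sum.distrib)
  qed
  have factor: "perturbed x l (Min e) (Max e) = fps_const (xe e) * fps_X ^ le e + fps_const (je e)" for e
    unfolding perturbed_def[of x l, OF x_skew x_diag l_sym l_pos] entry_def[of x l, OF x_skew x_diag l_sym l_pos]
      xe_def le_def je_def by (subst standard_form_const) simp
  \<comment> \<open>\<open>M\<close> is the set of edges whose factor is taken from
    \<open>A(t)\<close>; the other edges take the constant from the standard form.\<close>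
  have "(\<Prod>e\<in>P. perturbed x l (Min e) (Max e))
      = (\<Sum>M\<in>Pow P. (\<Prod>e\<in>M. fps_const (xe e) * fps_X ^ le e) * (\<Prod>e\<in>P - M. fps_const (je e)))"
    unfolding factor by (rule prod_add[OF P(1)])
  also have "\<dots> = (\<Sum>M\<in>Pow P. fps_const (prod xe M * prod je (P - M)) * fps_X ^ sum le M)"
    by (intro sum.cong refl) (simp add: prod.distrib fps_const_prod power_sum mult_ac flip: fps_const_mult)
  finally have "fps_nth (\<Prod>e\<in>P. perturbed x l (Min e) (Max e)) K
      = (\<Sum>M\<in>Pow P. if sum le M = K then prod xe M * prod je (P - M) else 0)"
    by (simp only: fps_sum_nth fps_nth_monomial)
  also have "\<dots> = (\<Sum>M\<in>{P}. if sum le M = K then prod xe M * prod je (P - M) else 0)"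
  proof (rule sum.mono_neutral_right)
    show "\<forall>M\<in>Pow P - {P}. (if sum le M = K then prod xe M * prod je (P - M) else 0) = 0"
    proof
      fix M assume M: "M \<in> Pow P - {P}"
      then have MP: "M \<subseteq> P" "M \<noteq> P" by auto
      then have less: "card M < card P" using P(1) by (intro psubset_card_mono) auto
      \<comment> \<open>A proper subset falls short by at least one full \<open>L\<close>, while
        \<open>sum b M\<close> and \<open>b0\<close> differ by at most
        \<open>2 * card P * N < L\<close>.\<close>
      have "sum le M \<noteq> K"
      proof
        assume "sum le M = K"
        then have eq: "sum b M + int (card M) * int L = int (card P) * int L + b0"
          using sum_le[OF MP(1)] KI by simp
        have "\<bar>sum b M\<bar> \<le> (\<Sum>e\<in>M. \<bar>b e\<bar>)" by (rule sum_abs)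
        also have "\<dots> \<le> of_nat (card M) * int N" using b by (intro sum_bounded_above) auto
        also have "\<dots> \<le> int (card P) * int N" using less by (intro mult_right_mono) auto
        finally have bM: "\<bar>sum b M\<bar> \<le> int (card P) * int N" by simp
        have "(int (card M) + 1) * int L \<le> int (card P) * int L" using less by (intro mult_right_mono) auto
        then have "int (card M) * int L + int L \<le> int (card P) * int L" by (simp add: algebra_simps)
        moreover have "int L = 2 * (int (card P) * int N) + int N + 1" by (simp add: L)
        ultimately show False using eq bM b0 unfolding of_nat_mult by linarith
      qed
      then show "(if sum le M = K then prod xe M * prod je (P - M) else 0) = 0" by simp
    qed
  qed (use P in auto)
  also have "\<dots> = (if sum b P = b0 then prod xe P else 0)"
  proof -
    have "sum le P = K \<longleftrightarrow> int (sum le P) = int K" by (simp only: of_nat_eq_iff)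
    also have "\<dots> \<longleftrightarrow> sum b P = b0" unfolding sum_le[OF order_refl] KI by simp
    finally show ?thesis by simp
  qed
  finally show ?thesis by (simp add: K_def xe_def)
qed

text \<open>\<open>K\<close> bounds the degree of the extracted coefficient, using at most
  \<open>n ^ 2\<close> edges. The summand 4 counts the two initial constants and the two gates that
  place the output last.\<close>

definition size_bound :: "nat poly" where
  "size_bound = (let X = [:0, 1:]; K = X * (X ^ 3 + 2 * X ^ 2 + 1) in
     4 + X * ((K + 1) * ((X + 1) * (5 * X + 15))))"

lemma poly_size_bound:
  "poly size_bound n = 4 + n * ((n * (n ^ 3 + 2 * n ^ 2 + 1) + 1) * ((n + 1) * (5 * n + 15)))"
  by (simp add: size_bound_def Let_def) (simp add: algebra_simps)

lemma face_circuit: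
  fixes E :: "nat set set"
  assumes G: "simple_graph n E"
    and face: "is_face Q (NPT (tutte_pfaffian n E :: (nat set, 'a::field) mpoly))"
  shows "\<exists>C :: (nat set, 'a) circuit. weakly_skew C \<and>
    circuit_poly C = restrict_poly (tutte_pfaffian n E) Q \<and> length C \<le> poly size_bound n"
proof -
  let ?PM = "perfect_matchings n E"
  obtain w :: "nat set \<Rightarrow> real" and c where valid: "\<And>P. P \<in> ?PM \<Longrightarrow> c \<le> sum w P"
    and restr: "restrict_poly (tutte_pfaffian n E :: (nat set, 'a) mpoly) Q
      = (\<Sum>P | P \<in> ?PM \<and> sum w P = c. of_int (matching_sign n P) * (\<Prod>e\<in>P. mvar e))"
    using face_of_tutte_pfaffian[OF G face] by blast
  let ?f = "restrict_poly (tutte_pfaffian n E :: (nat set, 'a) mpoly) Q"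
  have "\<exists>N'. computable N' {?f} \<and> N' + 2 \<le> poly size_bound n"
  \<comment> \<open>Without such a matching, for instance for the empty face, the restriction is the
    zero polynomial.\<close>
  proof (cases "\<exists>P0\<in>?PM. sum w P0 = c")
    case False
    then have none: "{P. P \<in> ?PM \<and> sum w P = c} = {}" by blast
    have f0: "?f = mconst 0" unfolding restr none by (simp add: mconst_def)
    have "computable 1 {?f}"
      unfolding f0 using computable_const[OF computable_empty] by simp
    moreover have "1 + 2 \<le> poly size_bound n" by (simp add: poly_size_bound)
    ultimately show ?thesis by blast
  next
    case True
    then obtain P0 where P0: "P0 \<in> ?PM" "sum w P0 = c" by blast
    define N where "N = card E"
    obtain b :: "nat set \<Rightarrow> int" where b: "\<And>e. \<bar>b e\<bar> \<le> int N"
      and bP: "\<And>P. P \<in> ?PM \<Longrightarrow> (sum w P = c) = (sum b P = sum b P0)"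
      using face_integral_weight[OF G P0 valid] unfolding N_def by blast
    define m where "m = card P0"
    have n: "n = 2 * m" using perfect_matching_card(1)[OF G P0(1)] by (simp add: m_def)
    \<comment> \<open>The summand \<open>2 * m * N\<close> separates matchings by the number of
      edges taken from the graph, and \<open>N + 1\<close> makes every exponent
      \<open>b e + L\<close> positive.\<close>
    define L where "L = 2 * m * N + N + 1"
    define l where "l i j = nat (b {i, j} + int L)" for i j
    define x where "x = (tutte_matrix E :: nat \<Rightarrow> nat \<Rightarrow> (nat set, 'a) mpoly)"
    \<comment> \<open>Common degree of the matchings in the face: each of the \<open>m\<close> edges
      contributes a shift \<open>L\<close>, and their \<open>b\<close>-weights add up to that of
      \<open>P0\<close>.\<close>
    define K where "K = nat (int (m * L) + sum b P0)"
    have x_skew: "x i j = - x j i" for i j unfolding x_def by (rule tutte_matrix_skew)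
    have x_diag: "x i i = 0" for i by (simp add: x_def tutte_matrix_def)
    have x_label: "input_label (x i j)" for i j unfolding x_def by (rule tutte_matrix_label)
    have l_sym: "l i j = l j i" for i j by (simp add: l_def insert_commute)
    have l_pos: "0 < l i j" for i j
    proof -
      have "0 \<le> int (2 * m * N)" by simp
      then have "int N < int L" unfolding L_def by linarith
      then show ?thesis using b[of "{i, j}"] by (simp add: l_def)
    qed
    have "\<bar>sum b P0\<bar> \<le> (\<Sum>e\<in>P0. \<bar>b e\<bar>)" by (rule sum_abs)
    also have "\<dots> \<le> of_nat (card P0) * int N" using b by (intro sum_bounded_above) auto
    finally have b0: "\<bar>sum b P0\<bar> \<le> int (m * N)" by (simp add: m_def)
    have comp: "computable (2 + n * ((K + 1) * ((n + 1) * (5 * n + 15))))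
        (fps_nth (pf_list (perturbed x l) [1..<Suc n]) ` {..K})"
      by (rule computable_pf_series[OF x_skew x_diag l_sym l_pos x_label]) (simp add: n)
    have set: "set [1..<Suc n] = {1..n}" by auto
    have EC: "E \<subseteq> complete_edges n" using G by (simp add: simple_graph_def)
    have sub: "?PM \<subseteq> pairings {1..n}"
      using EC unfolding perfect_matchings_complete[symmetric] by (auto simp: perfect_matchings_def)
    have "fps_nth (pf_list (perturbed x l) [1..<Suc n]) K = (\<Sum>P\<in>pairings {1..n}.
        (- 1) ^ inversion_count (matching_word P) * fps_nth (\<Prod>e\<in>P. perturbed x l (Min e) (Max e)) K)"
      by (subst pf_list_pairings) (simp_all only: sorted_wrt_upt set fps_sum_nth fps_nth_sign_mult)
    also have "\<dots> = (\<Sum>P\<in>pairings {1..n}. of_int (matching_sign n P) *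
        (if sum b P = sum b P0 then \<Prod>e\<in>P. x (Min e) (Max e) else 0))"
    proof (intro sum.cong refl arg_cong2[where f = "(*)"])
      fix P assume P: "P \<in> pairings {1..n}"
      show "(- 1) ^ inversion_count (matching_word P) = (of_int (matching_sign n P) :: (nat set, 'a) mpoly)"
        by (simp add: matching_sign_inversions[OF P])
      have "simple_graph n (complete_edges n)" by (simp add: simple_graph_def)
      moreover have "P \<in> perfect_matchings n (complete_edges n)"
        using P by (simp only: perfect_matchings_complete)
      ultimately have card: "2 * card P = n" "finite P" by (rule perfect_matching_card)+
      then have m: "card P = m" using n by simp
      show "fps_nth (\<Prod>e\<in>P. perturbed x l (Min e) (Max e)) K
          = (if sum b P = sum b P0 then \<Prod>e\<in>P. x (Min e) (Max e) else 0)"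
        unfolding K_def l_def[abs_def] m[symmetric]
        by (rule perturbed_pf_coefficient[OF x_skew x_diag b card(2)])
          (use pairing_block(3)[OF P] b0 in \<open>auto simp: m L_def\<close>)
    qed
    also have "\<dots> = (\<Sum>P | P \<in> ?PM \<and> sum w P = c. of_int (matching_sign n P) * (\<Prod>e\<in>P. mvar e))"
    proof (rule sum.mono_neutral_cong_right)
      show "finite (pairings {1..n})" by (simp add: finite_pairings)
      show "{P. P \<in> ?PM \<and> sum w P = c} \<subseteq> pairings {1..n}" using sub by blast
      show "\<forall>P\<in>pairings {1..n} - {P. P \<in> ?PM \<and> sum w P = c}. of_int (matching_sign n P) *
          (if sum b P = sum b P0 then \<Prod>e\<in>P. x (Min e) (Max e) else 0) = 0"
      proof
        fix P assume P: "P \<in> pairings {1..n} - {P. P \<in> ?PM \<and> sum w P = c}"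
        \<comment> \<open>A pairing of the right weight outside the face cannot be a matching of the
          graph, so it contains a non-edge, where the Tutte matrix vanishes.\<close>
        have "(\<Prod>e\<in>P. x (Min e) (Max e)) = 0" if "sum b P = sum b P0"
        proof -
          have "P \<notin> ?PM" using P bP[of P] that by blast
          moreover have "partition_on {1..n} P" using P by (simp add: pairings_def)
          ultimately obtain e where e: "e \<in> P" "e \<notin> E" by (auto simp: perfect_matchings_def)
          have PP: "P \<in> pairings {1..n}" using P by blast
          have "{Min e, Max e} = e" using pairing_block(3)[OF PP e(1)] by (rule sym)
          then have "x (Min e) (Max e) = 0" using e(2) by (simp add: x_def tutte_matrix_def insert_commute)
          moreover have "finite P" using finite_pairing[OF PP] by simp
          ultimately show ?thesis using e(1) by (meson prod_zero)
        qed
        then show "of_int (matching_sign n P) *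
          (if sum b P = sum b P0 then \<Prod>e\<in>P. x (Min e) (Max e) else 0) = 0" by simp
      qed
      fix P assume "P \<in> {P. P \<in> ?PM \<and> sum w P = c}"
      then have P: "P \<in> ?PM" "sum w P = c" by auto
      have "x (Min e) (Max e) = mvar e" if "e \<in> P" for e
      proof -
        have PP: "P \<in> pairings {1..n}" using sub P(1) by blast
        have "e \<in> E" using that P(1) by (auto simp: perfect_matchings_def)
        then show ?thesis using pairing_block(2,3)[OF PP that] by (simp add: x_def tutte_matrix_def)
      qed
      then show "of_int (matching_sign n P) * (if sum b P = sum b P0 then \<Prod>e\<in>P. x (Min e) (Max e) else 0)
          = of_int (matching_sign n P) * (\<Prod>e\<in>P. mvar e)"
        using P bP[OF P(1)] by simp
    qed
    finally have "?f = fps_nth (pf_list (perturbed x l) [1..<Suc n]) K" by (simp only: restr)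
    then have "computable (2 + n * ((K + 1) * ((n + 1) * (5 * n + 15)))) {?f}"
      using comp by (auto intro: computable_mono)
    moreover have "2 + n * ((K + 1) * ((n + 1) * (5 * n + 15))) + 2 \<le> poly size_bound n"
    proof -
      have "N \<le> card (complete_edges n)" unfolding N_def using EC finite_complete_edges by (rule card_mono[rotated])
      also have "card (complete_edges n) = n choose 2"
        unfolding complete_edges_def using n_subsets[of "{1..n}" 2] by simp
      also have "\<dots> \<le> n * (n - 1)" by (simp add: choose_two)
      also have "\<dots> \<le> n ^ 2" unfolding power2_eq_square by (intro mult_le_mono2) simp
      finally have N: "N \<le> n ^ 2" .
      \<comment> \<open>Inserting \<open>L\<close> and \<open>n = 2 * m\<close> makes this
        \<open>m * (n * N + 2 * N + 1)\<close>, to which \<open>N <= n ^ 2\<close> applies.\<close>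
      have "K \<le> m * L + m * N" using b0 unfolding K_def by linarith
      also have "\<dots> = m * (n * N + 2 * N + 1)" by (simp add: L_def n algebra_simps)
      also have "\<dots> \<le> n * (n * n ^ 2 + 2 * n ^ 2 + 1)"
        using N by (intro mult_le_mono add_le_mono) (simp_all add: n)
      also have "\<dots> = n * (n ^ 3 + 2 * n ^ 2 + 1)" by (simp add: power3_eq_cube power2_eq_square)
      finally have "n * ((K + 1) * ((n + 1) * (5 * n + 15)))
          \<le> n * ((n * (n ^ 3 + 2 * n ^ 2 + 1) + 1) * ((n + 1) * (5 * n + 15)))"
        by (intro mult_le_mono2 mult_le_mono1) simp
      then show ?thesis unfolding poly_size_bound by linarith
    qed
    ultimately show ?thesis by blast
  qed
  then obtain N' where N': "computable N' {?f}" "N' + 2 \<le> poly size_bound n" by blast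
  obtain C where C: "weakly_skew C" "circuit_poly C = ?f" "length C \<le> N' + 2"
    by (rule computable_weakly_skew[OF N'(1)])
  show ?thesis using C N'(2) by (intro exI[of _ C] conjI) simp_all
qed

theorem theorem5p3:
  shows
    "(\<forall>(G :: nat \<Rightarrow> nat set set) (Q :: nat \<Rightarrow> (nat set \<Rightarrow>\<^sub>0 real) set).
        (\<forall>n. simple_graph n (G n) \<and>
             is_face (Q n) (NPT (tutte_pfaffian n (G n) :: (nat set, 'a::alg_closed_field) mpoly)))
        \<longrightarrow> (\<lambda>n. restrict_poly (tutte_pfaffian n (G n) :: (nat set, 'a) mpoly) (Q n)) \<in> VP_ws)
     \<and>
     (\<exists>p :: nat poly. \<forall>n (E :: nat set set) (Q :: (nat set \<Rightarrow>\<^sub>0 real) set).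
        simple_graph n E \<and> is_face Q (NPT (tutte_pfaffian n E :: (nat set, 'a) mpoly))
        \<longrightarrow> (\<exists>C :: (nat set, 'a) circuit. weakly_skew C \<and>
               circuit_poly C = restrict_poly (tutte_pfaffian n E) Q \<and>
               length C \<le> poly p n))"
proof (intro conjI allI impI)
  fix G :: "nat \<Rightarrow> nat set set" and Q :: "nat \<Rightarrow> (nat set \<Rightarrow>\<^sub>0 real) set"
  assume "\<forall>n. simple_graph n (G n) \<and>
    is_face (Q n) (NPT (tutte_pfaffian n (G n) :: (nat set, 'a) mpoly))"
  then show "(\<lambda>n. restrict_poly (tutte_pfaffian n (G n) :: (nat set, 'a) mpoly) (Q n)) \<in> VP_ws"
    using face_circuit unfolding VP_ws_def mem_Collect_eq by (intro exI[of _ size_bound] allI) blast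
next
  show "\<exists>p :: nat poly. \<forall>n (E :: nat set set) (Q :: (nat set \<Rightarrow>\<^sub>0 real) set).
        simple_graph n E \<and> is_face Q (NPT (tutte_pfaffian n E :: (nat set, 'a) mpoly))
        \<longrightarrow> (\<exists>C :: (nat set, 'a) circuit. weakly_skew C \<and>
               circuit_poly C = restrict_poly (tutte_pfaffian n E) Q \<and>
               length C \<le> poly p n)"
    using face_circuit by (intro exI[of _ size_bound]) blast
qed

end
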